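(* Let $1<p<\infty$, $p'=p/(p-1)$, $0<\alpha<n/p$, let $w$ be a weight on $\mathbb{R}^n$ with $\sigma:=w^{1-p'}\in A_1$, and let $0\le V\in L^p_{loc}\cap L^p_{loc}(w)\cap L^p_{loc}(\sigma)$. Suppose that for any $\epsilon>0$ there exists $C(\epsilon)>0$ such that for any $\phi\in C_c^\infty(\mathbb{R}^n)$, $$\|V\phi\|_{L^p(w)}^p\le\epsilon\,\|(-\Delta)^{\frac{\alpha}{2}}\phi\|_{L^p(w)}^p+C(\epsilon)\|\phi\|_{L^p(w)}^p .$$ Then $$\lim_{\delta\to0}\sup\left\{\mu w(B(x_0,\delta))\left(\int_\delta^\infty\frac{\sigma(B(x_0,t))}{t^{(n-\alpha)p'+1}}\,dt\right)^{p-1}:\ x_0\in\mathbb{R}^n\right\}=0,$$ where $\mu w(E):=\int_E|V|^pw\,dx$.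
   Context: $\sigma\in A_1$ means $\sup_Q\big(\frac1{|Q|}\int_Q\sigma\,dx\big)(\operatorname{ess\,inf}_Q\sigma)^{-1}<\infty$ over all cubes $Q$ with edges parallel to the axes. $\|f\|_{L^p(w)}^p=\int|f|^pw\,dx$ and $\sigma(E)=\int_E\sigma\,dx$. $(-\Delta)^{\alpha/2}$ is the Fourier multiplier operator with symbol $|\xi|^\alpha$. $B(x_0,t)$ is the ball of center $x_0$ and radius $t$. *)

theory Defs
  imports "HOL-Analysis.Analysis"
begin

text \<open>
  The space \<open>\<real>\<^sup>n\<close> is an arbitrary type \<open>'a\<close> of class \<open>euclidean_space\<close> with \<open>n = DIM('a)\<close>. Functions
  determined up to null sets are Lebesgue measurable and real-valued, with sign conditions
  imposed almost everywhere; possibly infinite quantities take values in \<open>ennreal\<close>.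
\<close>

section \<open>Weights and weighted Lebesgue spaces\<close>

definition weight :: "('a::euclidean_space \<Rightarrow> real) \<Rightarrow> bool" where
  "weight w \<longleftrightarrow> w \<in> borel_measurable lebesgue \<and> (AE x in lebesgue. 0 < w x) \<and>
     (\<forall>K. compact K \<longrightarrow> (\<integral>\<^sup>+x\<in>K. ennreal (w x) \<partial>lebesgue) < \<infinity>)"

definition weighted_measure :: "('a::euclidean_space \<Rightarrow> real) \<Rightarrow> 'a set \<Rightarrow> ennreal" where
  "weighted_measure w E = (\<integral>\<^sup>+x\<in>E. ennreal (w x) \<partial>lebesgue)"

text \<open>The \<open>p\<close>-th power of the norm of \<open>L\<^sup>p(w)\<close>.\<close>

definition Lp_norm_pow ::
    "real \<Rightarrow> ('a::euclidean_space \<Rightarrow> real) \<Rightarrow> ('a \<Rightarrow> 'b::real_normed_vector) \<Rightarrow> ennreal" where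
  "Lp_norm_pow p w f = (\<integral>\<^sup>+x. ennreal (norm (f x) powr p * w x) \<partial>lebesgue)"

definition Lp_loc :: "real \<Rightarrow> ('a::euclidean_space \<Rightarrow> real) \<Rightarrow> ('a \<Rightarrow> real) set" where
  "Lp_loc p w = {f \<in> borel_measurable lebesgue.
     \<forall>K. compact K \<longrightarrow> (\<integral>\<^sup>+x\<in>K. ennreal (\<bar>f x\<bar> powr p * w x) \<partial>lebesgue) < \<infinity>}"

section \<open>The Muckenhoupt class \<open>A\<^sub>1\<close>\<close>

definition essinf :: "'a measure \<Rightarrow> ('a \<Rightarrow> ennreal) \<Rightarrow> ennreal" where
  "essinf M f = Sup {z. AE x in M. z \<le> f x}"

text \<open>The axis-parallel closed cube with lower corner \<open>a\<close> and edge length \<open>r\<close>.\<close>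

definition cube :: "'a::euclidean_space \<Rightarrow> real \<Rightarrow> 'a set" where
  "cube a r = cbox a (a + r *\<^sub>R One)"

text \<open>
  In \<open>ennreal\<close>, \<open>inverse 0 = \<infinity>\<close>; so a weight whose essential infimum vanishes on some cube has
  infinite supremum here.
\<close>

definition A1 :: "('a::euclidean_space \<Rightarrow> real) set" where
  "A1 = {\<sigma> \<in> borel_measurable lebesgue.
     (SUP (a, r) \<in> UNIV \<times> {0<..}.
        (weighted_measure \<sigma> (cube a r) / emeasure lebesgue (cube a r)) *
        inverse (essinf (lebesgue_on (cube a r)) (\<lambda>x. ennreal (\<sigma> x)))) < \<infinity>}"

section \<open>Test functions and the fractional Laplacian\<close>

fun Ck :: "nat \<Rightarrow> ('a::euclidean_space \<Rightarrow> 'b::real_normed_vector) \<Rightarrow> bool" where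
  "Ck 0 f \<longleftrightarrow> continuous_on UNIV f"
| "Ck (Suc k) f \<longleftrightarrow> (\<forall>x. f differentiable (at x)) \<and>
     (\<forall>i\<in>Basis. Ck k (\<lambda>x. frechet_derivative f (at x) i))"

definition Cc_infinity :: "('a::euclidean_space \<Rightarrow> complex) set" where
  "Cc_infinity = {\<phi>. (\<forall>k. Ck k \<phi>) \<and> compact (closure {x. \<phi> x \<noteq> 0})}"

definition fourier :: "('a::euclidean_space \<Rightarrow> complex) \<Rightarrow> 'a \<Rightarrow> complex" where
  "fourier f \<xi> = (LINT x|lebesgue. cis (- (x \<bullet> \<xi>)) * f x)"

definition inverse_fourier :: "('a::euclidean_space \<Rightarrow> complex) \<Rightarrow> 'a \<Rightarrow> complex" where
  "inverse_fourier g x =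
     complex_of_real (1 / (2 * pi) ^ DIM('a)) * (LINT \<xi>|lebesgue. cis (x \<bullet> \<xi>) * g \<xi>)"

definition fourier_multiplier ::
    "('a::euclidean_space \<Rightarrow> real) \<Rightarrow> ('a \<Rightarrow> complex) \<Rightarrow> 'a \<Rightarrow> complex" where
  "fourier_multiplier m f = inverse_fourier (\<lambda>\<xi>. complex_of_real (m \<xi>) * fourier f \<xi>)"

text \<open>
  \<open>frac_laplacian s\<close> is \<open>(-\<Delta>)\<^sup>s\<close>. On test functions, with \<open>s > 0\<close>, the integrals above
  converge absolutely.
\<close>

definition frac_laplacian :: "real \<Rightarrow> ('a::euclidean_space \<Rightarrow> complex) \<Rightarrow> 'a \<Rightarrow> complex" where
  "frac_laplacian s = fourier_multiplier (\<lambda>\<xi>. norm \<xi> powr (2 * s))"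

section \<open>Real powers of extended nonnegative reals\<close>

text \<open>Only meant for exponents \<open>a > 0\<close>.\<close>

definition ennreal_powr :: "ennreal \<Rightarrow> real \<Rightarrow> ennreal" where
  "ennreal_powr x a = (if x = \<infinity> then \<infinity> else ennreal (enn2real x powr a))"

end

theory Submission
  imports Defs "HOL-Probability.Characteristic_Functions" "HOL-Real_Asymp.Real_Asymp"
begin

text \<open>
  The hypothesis is tested on bump functions \<open>\<phi>\<close> adapted to the ball \<open>B = B(x\<^sub>0, \<delta>)\<close>, that is
  \<open>\<phi> x = \<eta> ((x - x\<^sub>0) / \<delta>)\<close> with \<open>\<eta>\<close> smooth, supported in the ball of radius \<open>2\<close> and at least \<open>1\<close> on the unit
  ball. The left-hand side is then at least \<open>\<mu>w B\<close>.

  Let \<open>n\<close> be the dimension and \<open>S\<close> the \<open>\<sigma>\<close>-measure of the cube of centre \<open>x\<^sub>0\<close> and edge \<open>2\<delta>\<close>. The \<open>A\<^sub>1\<close>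
  condition bounds the mean of \<open>\<sigma>\<close> over a cube by its values there, and \<open>w = \<sigma>\<^bsup>1-p\<^esup>\<close>. Up to constants this gives,
  for all \<open>t \<ge> \<delta>\<close>, that \<open>B(x\<^sub>0, t)\<close> has \<open>\<sigma>\<close>-measure at most \<open>(t/\<delta>)\<^bsup>n\<^esup> S\<close> and \<open>w\<close>-measure at most
  \<open>t\<^bsup>np\<^esup> S\<^bsup>1-p\<^esup>\<close> (\<open>A1_dual_weight_bounds\<close>). Because \<open>\<alpha>p < n\<close>, the first bound shows
  that the tail integral, raised to the power \<open>p - 1\<close>, is at most \<open>S\<^bsup>p-1\<^esup> \<delta>\<^bsup>\<alpha>p-np\<^esup>\<close>
  (\<open>weighted_tail_integral_le\<close>). The second bound gives \<open>\<parallel>\<phi>\<parallel>\<^sup>p \<le> \<delta>\<^bsup>np\<^esup> S\<^bsup>1-p\<^esup>\<close> in \<open>L\<^sup>p(w)\<close>, again up to a constant.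

  The remaining norm is that of \<open>(-\<Delta>)\<^bsup>\<alpha>/2\<^esup> \<phi>\<close>, which is a function on all of space. By scaling it equals
  \<open>\<delta>\<^bsup>-\<alpha>\<^esup> g ((x - x\<^sub>0) / \<delta>)\<close> with \<open>g = (-\<Delta>)\<^bsup>\<alpha>/2\<^esup> \<eta>\<close>. If \<open>g\<close> decays like \<open>(1 + |x|)\<^bsup>-\<beta>\<^esup>\<close> for some \<open>\<beta> > n\<close>, then
  the growth of \<open>w\<close> above and a dyadic decomposition (\<open>dyadic_tail_bound\<close>) give the bound
  \<open>\<delta>\<^bsup>np-\<alpha>p\<^esup> S\<^bsup>1-p\<^esup>\<close>. Multiplying everything, all powers of \<open>S\<close> cancel and the quantity in question is at most a constant
  times \<open>\<epsilon> + C(\<epsilon>) \<delta>\<^bsup>\<alpha>p\<^esup>\<close>, uniformly in \<open>x\<^sub>0\<close>; let first \<open>\<delta>\<close> and then \<open>\<epsilon>\<close> tend to \<open>0\<close>.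

  The decay of \<open>g\<close> (\<open>frac_laplacian_bump_decay\<close>) is the analytic core. An integer power of the Laplacian maps bumps
  to bumps, so only the symbol \<open>|\<xi>|\<^bsup>a\<^esup>\<close> with \<open>0 \<le> a < 2\<close> matters. For \<open>a > 0\<close> it is a constant times the integral of
  \<open>(1 - exp(-t|\<xi>|\<^sup>2)) t\<^bsup>-1-a/2\<^esup>\<close> over \<open>t > 0\<close>, so that \<open>g\<close> is an integral over \<open>t\<close> of a bump minus its heat flow.
  Away from the support of the bump only the heat flow remains, by Fourier inversion off the support, and the Gaussian bound for
  the heat kernel yields \<open>\<beta> = n + a\<close> (\<open>fractional_power_decay\<close>). For \<open>a = 0\<close> inversion off the support alone shows
  that \<open>g\<close> vanishes away from the origin.
\<close>

section \<open>Weights whose dual weight is of class \<open>A\<^sub>1\<close>\<close>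

text \<open>
  The supremum defining the essential infimum is the limit of a sequence, so that only countably
  many exceptional null sets have to be united.
\<close>
lemma AE_essinf_le: "AE x in M. essinf M f \<le> f x"
proof -
  let ?Z = "{z. AE x in M. z \<le> f x}"
  have "0 \<in> ?Z" by simp
  then have "?Z \<noteq> {}" by blast
  from ennreal_Sup_countable_SUP[OF this]
  obtain z where z: "range z \<subseteq> ?Z" "Sup ?Z = (SUP i::nat. z i)" by blast
  have "AE x in M. \<forall>i. z i \<le> f x"
    using z(1) by (intro AE_all_countable[THEN iffD2]) auto
  then show ?thesis
    unfolding essinf_def z(2) by eventually_elim (auto intro: SUP_least)
qed

lemma emeasure_cube: "0 < r \<Longrightarrow> emeasure lebesgue (cube (a::'a::euclidean_space) r) = ennreal (r ^ DIM('a))"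
  by (simp add: cube_def emeasure_lborel_cbox_eq inner_simps)

lemma nonnegligible_AE_witness:
  assumes "AE x in M. x \<in> A \<longrightarrow> P x" "A \<in> sets M" "emeasure M A \<noteq> 0"
  obtains x where "x \<in> A" "P x"
proof -
  have "\<not> (AE x in M. x \<notin> A)"
    using assms(2,3) AE_iff_null_sets[OF assms(2)] by auto
  moreover have "AE x in M. x \<notin> A" if "\<not> (\<exists>x\<in>A. P x)"
    using assms(1) by eventually_elim (use that in blast)
  ultimately show thesis using that by blast
qed

text \<open>
  The form in which the condition is used: on every cube the mean of \<open>\<sigma>\<close> is at most \<open>K\<close> times the
  values of \<open>\<sigma>\<close>, almost everywhere. Finiteness of the supremum forces the essential infimum over a cube to be positive,
  because the mean is, and it is finite because \<open>\<sigma>\<close> is real-valued; hence the mean is finite as well.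
\<close>
lemma A1_cube_bound:
  fixes \<sigma> :: "'a::euclidean_space \<Rightarrow> real"
  assumes A1: "\<sigma> \<in> A1" and pos: "AE x in lebesgue. 0 < \<sigma> x"
  obtains K where "0 < K"
    "\<And>a r. 0 < r \<Longrightarrow> \<exists>S>0. weighted_measure \<sigma> (cube a r) = ennreal S \<and>
       (AE x in lebesgue. x \<in> cube a r \<longrightarrow> S \<le> K * r ^ DIM('a) * \<sigma> x)"
proof -
  define F where "F = (\<lambda>(a, r). (weighted_measure \<sigma> (cube a r) / emeasure lebesgue (cube a r)) *
        inverse (essinf (lebesgue_on (cube a r)) (\<lambda>x. ennreal (\<sigma> x))))"
  define K where "K = (SUP z \<in> UNIV \<times> {0<..}. F z)"
  have [measurable]: "\<sigma> \<in> borel_measurable lebesgue" using A1 by (simp add: A1_def)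
  have Kfin: "K < \<infinity>" using A1 by (simp add: A1_def K_def F_def)
  define k where "k = enn2real K + 1"
  have Kk: "K \<le> ennreal k" and k0: "0 < k"
    using Kfin by (auto simp: k_def ennreal_enn2real_if enn2real_nonneg add_nonneg_pos intro: order.trans[of _ "ennreal (enn2real K)"] ennreal_leI)
  show thesis
  proof (rule that[OF k0])
    fix a :: 'a and r :: real assume r: "0 < r"
    let ?Q = "cube a r"
    let ?W = "weighted_measure \<sigma> ?Q"
    have Qm[measurable]: "?Q \<in> sets lebesgue" by (simp add: cube_def)
    define e where "e = essinf (lebesgue_on ?Q) (\<lambda>x. ennreal (\<sigma> x))"
    have le: "AE x in lebesgue. x \<in> ?Q \<longrightarrow> e \<le> ennreal (\<sigma> x)"
      using AE_essinf_le[of "lebesgue_on ?Q" "\<lambda>x. ennreal (\<sigma> x)"]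
      by (subst (asm) AE_restrict_space_iff) (auto simp: e_def)
    have m: "emeasure lebesgue ?Q = ennreal (r ^ DIM('a))" using r by (rule emeasure_cube)
    have mne: "emeasure lebesgue ?Q \<noteq> 0" using r by (simp add: m del: ennreal_power)
    obtain y where "e \<le> ennreal (\<sigma> y)"
      using nonnegligible_AE_witness[OF le Qm mne] by blast
    then have einf: "e < \<infinity>" by (simp add: le_less_trans)
    have W0: "?W \<noteq> 0"
    proof
      assume "?W = 0"
      then have "AE x in lebesgue. ennreal (\<sigma> x) * indicator ?Q x = 0"
        unfolding weighted_measure_def by (subst (asm) nn_integral_0_iff_AE) auto
      with pos have "AE x in lebesgue. x \<in> ?Q \<longrightarrow> False"
        by eventually_elim (auto split: split_indicator_asm)
      from nonnegligible_AE_witness[OF this Qm mne] show False by blast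
    qed
    have "F (a, r) \<le> K" unfolding K_def using r by (intro SUP_upper) auto
    then have *: "?W / ennreal (r ^ DIM('a)) * inverse e \<le> ennreal k"
      using Kk by (simp add: F_def e_def m)
    have e0: "e \<noteq> 0"
    proof
      assume "e = 0"
      moreover have "?W / ennreal (r ^ DIM('a)) \<noteq> 0"
        using W0 r by (simp add: ennreal_divide_eq_0_iff del: ennreal_power)
      ultimately show False using * by (auto simp: ennreal_mult_eq_top_iff top_unique)
    qed
    obtain e' where e': "e = ennreal e'" "0 < e'"
      using einf e0 by (cases e) (auto simp: less_le)
    have Wfin: "?W \<noteq> \<infinity>"
    proof
      assume "?W = \<infinity>"
      then have "?W / ennreal (r ^ DIM('a)) * inverse e = \<infinity>"
        using e' by (simp add: inverse_ennreal ennreal_top_mult ennreal_top_divide del: ennreal_power)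
      with * show False by (auto simp: top_unique)
    qed
    then obtain S where S: "?W = ennreal S" "0 < S"
      using W0 by (cases ?W) (auto simp: less_le)
    have "S / r ^ DIM('a) * (1 / e') \<le> k"
      using * S e' r k0 by (simp add: inverse_ennreal divide_ennreal ennreal_mult[symmetric] field_simps del: ennreal_power)
    then have SS: "S \<le> k * r ^ DIM('a) * e'" using e' r by (simp add: field_simps)
    have "AE x in lebesgue. x \<in> ?Q \<longrightarrow> S \<le> k * r ^ DIM('a) * \<sigma> x"
      using le pos
    proof eventually_elim
      case (elim x)
      show ?case
      proof
        assume "x \<in> ?Q"
        then have "e' \<le> \<sigma> x" using elim e' by simp
        then have "k * r ^ DIM('a) * e' \<le> k * r ^ DIM('a) * \<sigma> x" using k0 r by (intro mult_left_mono) auto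
        then show "S \<le> k * r ^ DIM('a) * \<sigma> x" using SS by linarith
      qed
    qed
    then show "\<exists>S>0. ?W = ennreal S \<and> (AE x in lebesgue. x \<in> ?Q \<longrightarrow> S \<le> k * r ^ DIM('a) * \<sigma> x)"
      using S by blast
  qed
qed

definition centred_cube :: "'a::euclidean_space \<Rightarrow> real \<Rightarrow> 'a set" where
  "centred_cube x t = cube (x - t *\<^sub>R One) (2 * t)"

lemma centred_cube_alt: "centred_cube x t = cbox (x - t *\<^sub>R One) (x + t *\<^sub>R One)"
proof -
  have "x - t *\<^sub>R One + (2 * t) *\<^sub>R One = x + t *\<^sub>R (One :: 'a)"
    by (simp only: mult_2 scaleR_add_left) simp
  then show ?thesis by (simp only: centred_cube_def cube_def)
qed

lemma ball_subset_centred_cube: "ball x t \<subseteq> centred_cube x t"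
proof
  fix y assume "y \<in> ball x t"
  then have d: "norm (y - x) < t" by (simp add: dist_norm norm_minus_commute)
  have "\<bar>(y - x) \<bullet> i\<bar> \<le> t" if "i \<in> Basis" for i
    using Basis_le_norm[OF that, of "y - x"] d by simp
  then show "y \<in> centred_cube x t"
    by (fastforce simp: centred_cube_alt mem_box inner_simps abs_le_iff)
qed

lemma centred_cube_mono: "s \<le> t \<Longrightarrow> centred_cube x s \<subseteq> centred_cube x t"
  by (fastforce simp: centred_cube_alt mem_box inner_simps)

lemma weighted_measure_mono: "A \<subseteq> B \<Longrightarrow> weighted_measure w A \<le> weighted_measure w B"
  unfolding weighted_measure_def by (intro nn_integral_mono) (auto split: split_indicator)

text \<open>
  Here \<open>S x t\<close> is the \<open>\<sigma>\<close>-measure of the cube of centre \<open>x\<close> and edge \<open>2 * t\<close>. Integrating the pointwise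
  bound for the cube of size \<open>t\<close> over the cube of size \<open>s\<close> shows that \<open>S x\<close> grows at most like \<open>t ^ n\<close>.
  Since \<open>w = \<sigma> powr (1 - p)\<close>, the same lower bound on \<open>\<sigma>\<close> is an upper bound on \<open>w\<close>, which yields the
  last inequality; as \<open>S x s \<le> S x t\<close>, it can be stated with the smaller scale \<open>s\<close>.
\<close>
lemma A1_dual_weight_bounds:
  fixes w \<sigma> :: "'a::euclidean_space \<Rightarrow> real"
  assumes p: "1 < p" "p' = p / (p - 1)" and w: "weight w"
    and \<sigma>: "\<sigma> = (\<lambda>x. w x powr (1 - p'))" and A1: "\<sigma> \<in> A1"
  obtains K S where "0 < K" 
    "\<And>x t. 0 < t \<Longrightarrow> 0 < S x t"
    "\<And>x t. 0 < t \<Longrightarrow> weighted_measure \<sigma> (ball x t) \<le> ennreal (S x t)"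
    "\<And>x s t. 0 < s \<Longrightarrow> s \<le> t \<Longrightarrow> S x t \<le> K * (t / s) ^ DIM('a) * S x s"
    "\<And>x s t. 0 < s \<Longrightarrow> s \<le> t \<Longrightarrow>
       weighted_measure w (ball x t) \<le> ennreal (K * t powr (real DIM('a) * p) * S x s powr (1 - p))"
proof -
  let ?n = "DIM('a)"
  have wpos: "AE x in lebesgue. 0 < w x" and [measurable]: "w \<in> borel_measurable lebesgue"
    using w by (auto simp: weight_def)
  have pos: "AE x in lebesgue. 0 < \<sigma> x" using wpos by eventually_elim (simp add: \<sigma>)
  obtain K where K: "0 < K" and bd: "\<And>a r. 0 < r \<Longrightarrow> \<exists>S>0. weighted_measure \<sigma> (cube a r) = ennreal S \<and>
       (AE x in lebesgue. x \<in> cube a r \<longrightarrow> S \<le> K * r ^ ?n * \<sigma> x)"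
    using A1_cube_bound[OF A1 pos] by blast
  define S where "S = (\<lambda>x t. enn2real (weighted_measure \<sigma> (centred_cube x t)))"
  have S: "0 < S x t \<and> weighted_measure \<sigma> (centred_cube x t) = ennreal (S x t) \<and>
       (AE y in lebesgue. y \<in> centred_cube x t \<longrightarrow> S x t \<le> K * (2 * t) ^ ?n * \<sigma> y)" if t: "0 < t" for x t
    using bd[of "2 * t" "x - t *\<^sub>R One"] t by (auto simp: S_def centred_cube_def)
  have mono: "S x s \<le> S x t" if "0 < s" "s \<le> t" for x s t
    using weighted_measure_mono[OF centred_cube_mono[OF that(2)], of \<sigma> x] S[of s x] S[of t x] that by simp
  have Qm[measurable]: "centred_cube x t \<in> sets lebesgue" for x :: 'a and t by (simp add: centred_cube_alt)
  have em: "emeasure lebesgue (centred_cube x t) = ennreal ((2 * t) ^ ?n)" if "0 < t" for x :: 'a and t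
    using emeasure_cube[of "2 * t" "x - t *\<^sub>R One"] that by (simp add: centred_cube_def)
  have dbl: "S x t \<le> K * (t / s) ^ ?n * S x s" if st: "0 < s" "s \<le> t" for x s t
  proof -
    have t: "0 < t" using st by simp
    have "ennreal (S x t) * ennreal ((2 * s) ^ ?n) = (\<integral>\<^sup>+y. ennreal (S x t) * indicator (centred_cube x s) y \<partial>lebesgue)"
      by (subst nn_integral_cmult_indicator) (simp_all only: Qm em[OF st(1)])
    also have "\<dots> \<le> (\<integral>\<^sup>+y. ennreal (K * (2 * t) ^ ?n) * (ennreal (\<sigma> y) * indicator (centred_cube x s) y) \<partial>lebesgue)"
    proof (intro nn_integral_mono_AE)
      show "AE y in lebesgue. ennreal (S x t) * indicator (centred_cube x s) y
         \<le> ennreal (K * (2 * t) ^ ?n) * (ennreal (\<sigma> y) * indicator (centred_cube x s) y)"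
        using S[OF t, of x, THEN conjunct2, THEN conjunct2] pos
        by eventually_elim
          (use centred_cube_mono[OF st(2), of x] K t in
            \<open>auto split: split_indicator simp: ennreal_mult''[symmetric] intro!: ennreal_leI\<close>)
    qed
    also have "\<dots> = ennreal (K * (2 * t) ^ ?n) * ennreal (S x s)"
      using S[OF st(1), of x] by (subst nn_integral_cmult) (auto simp: weighted_measure_def \<sigma>)
    finally have "S x t * (2 * s) ^ ?n \<le> K * (2 * t) ^ ?n * S x s"
      using S[OF t, of x] S[OF st(1), of x] K t st by (simp add: ennreal_mult[symmetric] del: ennreal_power)
    then have "S x t \<le> K * ((2 * t) ^ ?n / (2 * s) ^ ?n) * S x s"
      using st by (simp add: field_simps)
    also have "(2 * t) ^ ?n / (2 * s) ^ ?n = (t / s) ^ ?n" by (simp add: power_divide[symmetric])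
    finally show ?thesis .
  qed
  define A where "A = 2 ^ ?n * (K * 2 ^ ?n) powr (p - 1)"
  have ww: "weighted_measure w (centred_cube x t) \<le> ennreal (A * t powr (?n * p) * S x s powr (1 - p))"
    if st: "0 < s" "s \<le> t" for x s t
  proof -
    have t: "0 < t" using st by simp
    \<comment> \<open>The identity behind \<open>w = \<sigma> powr (1 - p)\<close>.\<close>
    have pp: "(1 - p') * (1 - p) = 1" using p by (simp add: field_simps)
    let ?c = "(K * (2 * t) ^ ?n) powr (p - 1) * S x t powr (1 - p)"
    have "weighted_measure w (centred_cube x t) \<le> (\<integral>\<^sup>+y. ennreal ?c * indicator (centred_cube x t) y \<partial>lebesgue)"
      unfolding weighted_measure_def
    proof (intro nn_integral_mono_AE)
      show "AE y in lebesgue. ennreal (w y) * indicator (centred_cube x t) y \<le> ennreal ?c * indicator (centred_cube x t) y"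
        using S[OF t, of x, THEN conjunct2, THEN conjunct2] wpos
      proof eventually_elim
        case (elim y)
        have "w y \<le> ?c" if y: "y \<in> centred_cube x t"
        proof -
          have *: "S x t \<le> K * (2 * t) ^ ?n * \<sigma> y" using elim y by simp
          have "w y = \<sigma> y powr (1 - p)" using elim pp by (simp add: \<sigma> powr_powr)
          also have "\<dots> \<le> (S x t / (K * (2 * t) ^ ?n)) powr (1 - p)"
            using * K t S[OF t, of x] p
            by (intro powr_mono2') (auto simp: field_simps)
          also have "\<dots> = ?c"
            using K t S[OF t, of x] by (simp add: powr_divide powr_minus_divide[of _ "p - 1", symmetric] field_simps powr_diff)
          finally show ?thesis .
        qed
        then show ?case by (auto split: split_indicator intro: ennreal_leI)
      qed
    qed
    also have "\<dots> = ennreal (?c * (2 * t) ^ ?n)"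
      using t by (subst nn_integral_cmult_indicator)
        (simp_all only: Qm em[OF t], simp add: ennreal_mult''[symmetric])
    also have "\<dots> \<le> ennreal (A * t powr (?n * p) * S x s powr (1 - p))"
    proof (intro ennreal_leI)
      have "S x t powr (1 - p) \<le> S x s powr (1 - p)"
        using mono[OF st, of x] S[OF st(1), of x] p by (intro powr_mono2') auto
      moreover have "?c * (2 * t) ^ ?n = A * t powr (?n * p) * S x t powr (1 - p)"
      proof -
        have "(K * (2 * t) ^ ?n) powr (p - 1) = (K * 2 ^ ?n) powr (p - 1) * (t ^ ?n) powr (p - 1)"
          using K t by (simp add: power_mult_distrib powr_mult)
        moreover have "(t ^ ?n) powr (p - 1) * t ^ ?n = t powr (?n * p)"
          using t by (simp add: powr_realpow[symmetric] powr_powr powr_add[symmetric] algebra_simps)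
        ultimately show ?thesis by (simp add: A_def power_mult_distrib)
      qed
      ultimately show "?c * (2 * t) ^ ?n \<le> A * t powr (?n * p) * S x s powr (1 - p)"
        by (simp only:) (intro mult_left_mono; simp add: A_def)
    qed
    finally show ?thesis .
  qed
  have max: "K \<le> max K A" "A \<le> max K A" by auto
  show thesis
  proof (rule that[of "max K A" S])
    show "0 < max K A" using K by simp
    show "0 < S x t" if "0 < t" for x t using S[OF that] by blast
    show "weighted_measure \<sigma> (ball x t) \<le> ennreal (S x t)" if "0 < t" for x t
      using S[OF that, of x] weighted_measure_mono[OF ball_subset_centred_cube, of \<sigma> x t] by simp
    show "S x t \<le> max K A * (t / s) ^ ?n * S x s" if st: "0 < s" "s \<le> t" for x s t
      using dbl[OF st, of x] st S[OF st(1), of x]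
      by (elim order.trans) (intro mult_right_mono max; simp)
    show "weighted_measure w (ball x t) \<le> ennreal (max K A * t powr (?n * p) * S x s powr (1 - p))"
      if st: "0 < s" "s \<le> t" for x s t
    proof -
      have "A * t powr (?n * p) * S x s powr (1 - p) \<le> max K A * t powr (?n * p) * S x s powr (1 - p)"
        by (intro mult_right_mono max) auto
      with ww[OF st, of x] weighted_measure_mono[OF ball_subset_centred_cube, of w x t]
      show ?thesis by (meson ennreal_leI order.trans)
    qed
  qed
qed

section \<open>Smooth bump functions\<close>

lemma norm_sq_Basis: "(norm x)\<^sup>2 = (\<Sum>b\<in>Basis. (x \<bullet> b)\<^sup>2)"
  by (subst power2_norm_eq_inner, subst euclidean_inner) (simp add: power2_eq_square)

text \<open>
  The classical flat function \<open>exp (- 1 / t)\<close>, extended by \<open>0\<close> and multiplied by powers of \<open>1 / t\<close> so that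
  derivatives stay inside the family.
\<close>
definition flat_exp :: "nat \<Rightarrow> real \<Rightarrow> real" where
  "flat_exp k t = (if 0 < t then (1 / t) ^ k * exp (- (1 / t)) else 0)"

lemma flat_exp_over_tendsto_0: "((\<lambda>t. flat_exp k t / t) \<longlongrightarrow> 0) (at 0)"
proof (rule filterlim_split_at)
  have "eventually (\<lambda>t. flat_exp k t / t = 0) (at_left 0)"
    by (auto simp: flat_exp_def eventually_at_filter)
  then show "((\<lambda>t. flat_exp k t / t) \<longlongrightarrow> 0) (at_left 0)"
    by (rule tendsto_eventually)
  have "((\<lambda>t::real. inverse t ^ Suc k / exp (inverse t)) \<longlongrightarrow> 0) (at_right 0)"
    by (rule filterlim_compose[OF tendsto_power_div_exp_0 filterlim_inverse_at_top_right])
  then show "((\<lambda>t. flat_exp k t / t) \<longlongrightarrow> 0) (at_right 0)"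
    by (rule Lim_transform_eventually)
       (auto simp: flat_exp_def eventually_at_filter field_simps exp_minus power_divide)
qed

lemma flat_exp_has_derivative:
  "(flat_exp k has_real_derivative flat_exp (k + 2) t - real k * flat_exp (k + 1) t) (at t)"
proof (cases t "0::real" rule: linorder_cases)
  case less
  have "((\<lambda>_. 0) has_real_derivative 0) (at t)" by simp
  then have "(flat_exp k has_real_derivative 0) (at t)"
    by (rule has_field_derivative_transform_within_open[of _ _ _ "{..<0}"])
       (use less in \<open>auto simp: flat_exp_def\<close>)
  then show ?thesis using less by (simp add: flat_exp_def)
next
  case equal
  have "(flat_exp k has_real_derivative 0) (at 0)"
    using flat_exp_over_tendsto_0[of k] by (simp add: has_field_derivative_iff flat_exp_def)
  then show ?thesis using equal by (simp add: flat_exp_def)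
next
  case greater
  have i: "((\<lambda>t. 1 / t) has_real_derivative - ((1 / t) ^ 2)) (at t)"
    using greater by (auto intro!: derivative_eq_intros simp: field_simps power2_eq_square)
  have "((\<lambda>t. (1 / t) ^ k) has_real_derivative - (real k * (1 / t) ^ (k + 1))) (at t)"
    using DERIV_power[OF i, of k] by (cases k) (simp_all add: power2_eq_square mult_ac)
  from DERIV_mult[OF this DERIV_fun_exp[OF DERIV_minus[OF i]]]
  have "((\<lambda>t. (1 / t) ^ k * exp (- (1 / t))) has_real_derivative
     (1 / t) ^ (k + 2) * exp (- (1 / t)) - real k * ((1 / t) ^ (k + 1) * exp (- (1 / t)))) (at t)"
    by (rule DERIV_cong) (simp add: power2_eq_square mult_ac)
  then have "(flat_exp k has_real_derivative
     (1 / t) ^ (k + 2) * exp (- (1 / t)) - real k * ((1 / t) ^ (k + 1) * exp (- (1 / t)))) (at t)"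
    by (rule has_field_derivative_transform_within_open[of _ _ _ "{0<..}"])
       (use greater in \<open>auto simp: flat_exp_def\<close>)
  then show ?thesis using greater by (simp add: flat_exp_def)
qed

text \<open>
  A class of compactly supported functions that is closed under partial derivatives by
  construction, so that smoothness of all orders is a plain induction. The factor \<open>flat_exp\<close> in the
  generators cuts everything off outside the ball of radius \<open>2\<close>.
\<close>
inductive bump :: "('a::euclidean_space \<Rightarrow> complex) \<Rightarrow> bool" where
  bump_radial: "bump (\<lambda>x. complex_of_real (flat_exp k (4 - x \<bullet> x)))"
| bump_cmult: "bump f \<Longrightarrow> bump (\<lambda>x. c * f x)"
| bump_coord: "bump f \<Longrightarrow> bump (\<lambda>x. complex_of_real (x \<bullet> b) * f x)"
| bump_add: "bump f \<Longrightarrow> bump g \<Longrightarrow> bump (\<lambda>x. f x + g x)"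

lemma bump_zero: "bump (\<lambda>x::'a::euclidean_space. 0)"
  using bump_cmult[OF bump_radial, of 0] by simp

lemma bump_sum: "finite A \<Longrightarrow> (\<And>a. a \<in> A \<Longrightarrow> bump (f a)) \<Longrightarrow> bump (\<lambda>x. \<Sum>a\<in>A. f a x)"
  by (induction A rule: finite_induct) (auto intro: bump_zero bump_add)

lemma bump_support: "bump f \<Longrightarrow> 2 \<le> norm x \<Longrightarrow> f x = 0"
proof (induction rule: bump.induct)
  case (bump_radial k)
  have "2\<^sup>2 \<le> (norm x)\<^sup>2" using bump_radial by (intro power_mono) auto
  then show ?case by (simp add: flat_exp_def dot_square_norm)
qed auto

lemma bump_has_derivative:
  "bump f \<Longrightarrow> \<exists>D. (\<forall>b. bump (D b)) \<and>
     (\<forall>x. (f has_derivative (\<lambda>h. \<Sum>b\<in>Basis. complex_of_real (h \<bullet> b) * D b x)) (at x))"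
proof (induction rule: bump.induct)
  case (bump_radial k)
  define G where "G = (\<lambda>x::'a. complex_of_real (flat_exp (k + 2) (4 - x \<bullet> x)) + (- of_nat k) * complex_of_real (flat_exp (k + 1) (4 - x \<bullet> x)))"
  have G: "bump G" unfolding G_def by (intro bump.intros)
  define D where "D = (\<lambda>b x::'a. (- 2) * (complex_of_real (x \<bullet> b) * G x))"
  have "((\<lambda>x. complex_of_real (flat_exp k (4 - x \<bullet> x))) has_derivative
    (\<lambda>h. \<Sum>b\<in>Basis. complex_of_real (h \<bullet> b) * D b x)) (at x)" for x
  proof -
    have d: "((\<lambda>x. flat_exp k (4 - x \<bullet> x)) has_derivative
      (\<lambda>h. (- 2 * (x \<bullet> h)) * (flat_exp (k + 2) (4 - x \<bullet> x) - real k * flat_exp (k + 1) (4 - x \<bullet> x)))) (at x)"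
      by (rule has_derivative_eq_rhs[OF has_derivative_in_compose2[of UNIV "flat_exp k" "\<lambda>t s. s * (flat_exp (k + 2) t - real k * flat_exp (k + 1) t)" "\<lambda>x. 4 - x \<bullet> x" UNIV x "\<lambda>h. - 2 * (x \<bullet> h)"]])
         (use flat_exp_has_derivative[of k] in \<open>auto intro!: derivative_eq_intros simp: has_field_derivative_def mult.commute[of _ "_ - _"] inner_commute\<close>)
    have "complex_of_real ((- 2 * (x \<bullet> h)) * (flat_exp (k + 2) (4 - x \<bullet> x) - real k * flat_exp (k + 1) (4 - x \<bullet> x)))
       = (\<Sum>b\<in>Basis. complex_of_real (h \<bullet> b) * D b x)" for h
    proof -
      have "(\<Sum>b\<in>Basis. complex_of_real (h \<bullet> b) * D b x) = (- 2 * G x) * complex_of_real (\<Sum>b\<in>Basis. (x \<bullet> b) * (h \<bullet> b))"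
        unfolding D_def of_real_sum sum_distrib_left by (simp add: mult_ac)
      also have "(\<Sum>b\<in>Basis. (x \<bullet> b) * (h \<bullet> b)) = x \<bullet> h" by (rule euclidean_inner[symmetric])
      finally show ?thesis by (simp add: G_def algebra_simps)
    qed
    then show ?thesis using has_derivative_of_real[OF d, where 'a=complex] by simp
  qed
  moreover have "bump (D b)" for b unfolding D_def by (intro bump.intros G)
  ultimately show ?case by blast
next
  case (bump_cmult f c)
  then obtain D where D: "\<And>b. bump (D b)" "\<And>x. (f has_derivative (\<lambda>h. \<Sum>b\<in>Basis. complex_of_real (h \<bullet> b) * D b x)) (at x)"
    by blast
  have "((\<lambda>x. c * f x) has_derivative (\<lambda>h. \<Sum>b\<in>Basis. complex_of_real (h \<bullet> b) * (c * D b x))) (at x)" for x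
    by (rule has_derivative_eq_rhs[OF has_derivative_mult_right[OF D(2)]])
       (simp add: sum_distrib_left algebra_simps fun_eq_iff)
  with D(1) show ?case by (intro exI[of _ "\<lambda>b x. c * D b x"]) (auto intro: bump.intros)
next
  case (bump_coord f e)
  then obtain D where D: "\<And>b. bump (D b)" "\<And>x. (f has_derivative (\<lambda>h. \<Sum>b\<in>Basis. complex_of_real (h \<bullet> b) * D b x)) (at x)"
    by blast
  let ?D = "\<lambda>b x. complex_of_real (b \<bullet> e) * f x + complex_of_real (x \<bullet> e) * D b x"
  have "((\<lambda>x. complex_of_real (x \<bullet> e) * f x) has_derivative (\<lambda>h. \<Sum>b\<in>Basis. complex_of_real (h \<bullet> b) * ?D b x)) (at x)" for x
  proof (rule has_derivative_eq_rhs[OF has_derivative_mult[OF has_derivative_of_real[OF has_derivative_inner_left[OF has_derivative_ident]] D(2)]], rule ext)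
    fix h
    have "h \<bullet> e = (\<Sum>b\<in>Basis. (h \<bullet> b) * (b \<bullet> e))"
      by (subst euclidean_inner) (simp add: inner_commute)
    then show "complex_of_real (x \<bullet> e) * (\<Sum>b\<in>Basis. complex_of_real (h \<bullet> b) * D b x) + complex_of_real (h \<bullet> e) * f x
       = (\<Sum>b\<in>Basis. complex_of_real (h \<bullet> b) * ?D b x)"
      by (simp add: sum_distrib_left sum_distrib_right algebra_simps sum.distrib)
  qed
  with D(1) bump_coord show ?case by (intro exI[of _ ?D]) (auto intro!: bump.intros)
next
  case (bump_add f g)
  then obtain D E where D: "\<And>b. bump (D b)" "\<And>x. (f has_derivative (\<lambda>h. \<Sum>b\<in>Basis. complex_of_real (h \<bullet> b) * D b x)) (at x)"
    and E: "\<And>b. bump (E b)" "\<And>x. (g has_derivative (\<lambda>h. \<Sum>b\<in>Basis. complex_of_real (h \<bullet> b) * E b x)) (at x)"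
    by blast
  have "((\<lambda>x. f x + g x) has_derivative (\<lambda>h. \<Sum>b\<in>Basis. complex_of_real (h \<bullet> b) * (D b x + E b x))) (at x)" for x
    by (rule has_derivative_eq_rhs[OF has_derivative_add[OF D(2) E(2)]])
       (simp add: sum.distrib algebra_simps fun_eq_iff)
  with D(1) E(1) show ?case by (intro exI[of _ "\<lambda>b x. D b x + E b x"]) (auto intro: bump.intros)
qed

lemma bump_continuous: "bump f \<Longrightarrow> continuous_on S f"
  using bump_has_derivative[of f]
  by (meson continuous_at_imp_continuous_on has_derivative_continuous)

lemma bump_measurable [measurable_dest]: "bump f \<Longrightarrow> f \<in> borel_measurable borel"
  by (intro borel_measurable_continuous_onI bump_continuous)

lemma integrable_continuous_compact_support:
  fixes f :: "'a::euclidean_space \<Rightarrow> complex"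
  assumes "continuous_on UNIV f" "\<And>x. R \<le> norm x \<Longrightarrow> f x = 0"
  shows "integrable lborel f"
proof -
  have "integrable lborel (\<lambda>x. indicator (cball 0 R) x *\<^sub>R f x)"
    by (intro borel_integrable_compact continuous_on_subset[OF assms(1)]) auto
  also have "(\<lambda>x. indicator (cball 0 R) x *\<^sub>R f x) = f"
    using assms(2) by (auto simp: fun_eq_iff split: split_indicator)
  finally show ?thesis .
qed

lemma bump_integrable: "bump f \<Longrightarrow> integrable lborel f"
  by (intro integrable_continuous_compact_support[where R = 2] bump_continuous bump_support)

lemma bump_affine_Ck: "bump f \<Longrightarrow> Ck k (\<lambda>x. c * f (r *\<^sub>R (x - x0)))"
proof (induction k arbitrary: f c)
  case 0
  then show ?case
    by (auto intro!: continuous_intros continuous_on_compose2[OF bump_continuous[of f UNIV]])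
next
  case (Suc k)
  obtain D where D: "\<And>b. bump (D b)" "\<And>x. (f has_derivative (\<lambda>h. \<Sum>b\<in>Basis. complex_of_real (h \<bullet> b) * D b x)) (at x)"
    using bump_has_derivative[OF Suc.prems] by blast
  have d: "((\<lambda>x. c * f (r *\<^sub>R (x - x0))) has_derivative
     (\<lambda>h. c * (\<Sum>b\<in>Basis. complex_of_real ((r *\<^sub>R h) \<bullet> b) * D b (r *\<^sub>R (x - x0))))) (at x)" for x
    by (intro has_derivative_mult_right has_derivative_compose[OF _ D(2)])
       (auto intro!: derivative_eq_intros)
  have "(\<lambda>x. frechet_derivative (\<lambda>x. c * f (r *\<^sub>R (x - x0))) (at x) i) = (\<lambda>x. (c * of_real r) * D i (r *\<^sub>R (x - x0)))"
    if i: "i \<in> Basis" for i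
  proof
    fix x
    have "(\<Sum>b\<in>Basis. complex_of_real ((r *\<^sub>R i) \<bullet> b) * D b (r *\<^sub>R (x - x0))) = (\<Sum>b\<in>Basis. if i = b then complex_of_real r * D b (r *\<^sub>R (x - x0)) else 0)"
      by (intro sum.cong) (use i in \<open>auto simp: inner_Basis\<close>)
    also have "\<dots> = complex_of_real r * D i (r *\<^sub>R (x - x0))"
      using i by simp
    finally show "frechet_derivative (\<lambda>x. c * f (r *\<^sub>R (x - x0))) (at x) i = (c * of_real r) * D i (r *\<^sub>R (x - x0))"
      by (simp add: frechet_derivative_at[OF d, symmetric])
  qed
  then show ?case using d Suc.IH[OF D(1)] by (auto simp: differentiable_def)
qed

lemma bump_affine_Cc_infinity:
  assumes "bump f" "0 < r"
  shows "(\<lambda>x. c * f (r *\<^sub>R (x - x0))) \<in> Cc_infinity"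
proof -
  have "{x. c * f (r *\<^sub>R (x - x0)) \<noteq> 0} \<subseteq> cball x0 (2 / r)"
  proof
    fix x assume "x \<in> {x. c * f (r *\<^sub>R (x - x0)) \<noteq> 0}"
    then have "\<not> 2 \<le> norm (r *\<^sub>R (x - x0))" using bump_support[OF assms(1)] by auto
    then show "x \<in> cball x0 (2 / r)"
      using assms(2) by (simp add: dist_norm norm_minus_commute[of x0] pos_le_divide_eq mult.commute)
  qed
  then have "bounded {x. c * f (r *\<^sub>R (x - x0)) \<noteq> 0}" by (rule bounded_subset[OF bounded_cball])
  then show ?thesis
    using bump_affine_Ck[OF assms(1)] by (auto simp: Cc_infinity_def compact_closure)
qed

section \<open>The Fourier transform of a bump function\<close>

lemma cis_borel_measurable [measurable]: "cis \<in> borel_measurable borel"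
  by (intro borel_measurable_continuous_onI continuous_intros)

lemma fourier_lborel: "f \<in> borel_measurable borel \<Longrightarrow> fourier f \<xi> = (LINT x|lborel. cis (- (x \<bullet> \<xi>)) * f x)"
  unfolding fourier_def by (rule integral_completion) measurable

lemma fourier_measurable [measurable (raw)]:
  assumes [measurable]: "f \<in> borel_measurable borel"
  shows "fourier f \<in> borel_measurable borel"
proof -
  have "(\<lambda>\<xi>. LINT x|lborel. cis (- (x \<bullet> \<xi>)) * f x) \<in> borel_measurable borel"
    by measurable
  then show ?thesis by (simp add: fourier_lborel cong: measurable_cong)
qed

lemma integrable_cis_mult:
  fixes f :: "'a::euclidean_space \<Rightarrow> complex"
  assumes f: "integrable lborel f" and [measurable]: "g \<in> borel_measurable borel"
  shows "integrable lborel (\<lambda>x. cis (g x) * f x)"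
  by (rule Bochner_Integration.integrable_bound[OF f]) (use borel_measurable_integrable[OF f] in \<open>auto simp: norm_mult\<close>)

lemma norm_fourier_le:
  assumes f: "integrable lborel f"
  shows "norm (fourier f \<xi>) \<le> (LINT x|lborel. norm (f x))"
proof -
  have "norm (fourier f \<xi>) \<le> (LINT x|lborel. norm (cis (- (x \<bullet> \<xi>)) * f x))"
    using borel_measurable_integrable[OF f] by (subst fourier_lborel) auto
  also have "\<dots> = (LINT x|lborel. norm (f x))" by (simp add: norm_mult)
  finally show ?thesis .
qed

text \<open>
  Translation invariance makes the integral of every difference quotient vanish; the difference
  quotients are bounded by the maximum of the derivative and supported in a fixed ball, so dominated
  convergence passes to the derivative.
\<close>
lemma integral_partial_derivative_eq_0:
  fixes f :: "'a::euclidean_space \<Rightarrow> complex"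
  assumes d: "\<And>x. (f has_derivative f' x) (at x)"
    and cont: "continuous_on UNIV (\<lambda>x. f' x b)"
    and supp: "\<And>x. R \<le> norm x \<Longrightarrow> f x = 0"
    and supp': "\<And>x. R \<le> norm x \<Longrightarrow> f' x b = 0"
  shows "(LINT x|lborel. f' x b) = 0"
proof -
  have fc: "continuous_on UNIV f"
    using d by (meson continuous_at_imp_continuous_on has_derivative_continuous)
  then have [measurable]: "f \<in> borel_measurable borel" by (rule borel_measurable_continuous_onI)
  have [measurable]: "(\<lambda>x. f' x b) \<in> borel_measurable borel" using cont by (rule borel_measurable_continuous_onI)
  have fi: "integrable lborel f" by (rule integrable_continuous_compact_support[OF fc supp])
  have "bounded ((\<lambda>x. f' x b) ` cball 0 R)"
    by (intro compact_imp_bounded compact_continuous_image continuous_on_subset[OF cont]) auto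
  then obtain M where M: "0 < M" "\<And>x. x \<in> cball 0 R \<Longrightarrow> norm (f' x b) \<le> M"
    by (auto simp: bounded_pos)
  have Mb: "norm (f' x b) \<le> M" for x
    using M supp'[of x] by (cases "norm x \<le> R") auto
  have ftr: "integrable lborel (\<lambda>x. f (x + c)) \<and> (LINT x|lborel. f (x + c)) = (LINT x|lborel. f x)" for c
    using integrable_distr_eq[of "(+) c" lborel borel f] integral_distr[of "(+) c" lborel borel f] fi
    by (simp add: lborel_distr_plus add.commute)
  define h where "h = (\<lambda>n::nat. 1 / real (Suc n))"
  have h: "0 < h n" "h n \<le> 1" for n by (auto simp: h_def)
  define q where "q = (\<lambda>n x. (f (x + h n *\<^sub>R b) - f x) /\<^sub>R h n)"
  have q0: "(LINT x|lborel. q n x) = 0" for n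
    using ftr[of "h n *\<^sub>R b"] fi unfolding q_def by simp
  have lip: "norm (f (x + s *\<^sub>R b) - f x) \<le> M * \<bar>s\<bar>" for x s
  proof -
    have "norm ((\<lambda>s. f (x + s *\<^sub>R b)) s - (\<lambda>s. f (x + s *\<^sub>R b)) 0) \<le> M * norm (s - 0)"
    proof (rule differentiable_bound[of UNIV])
      fix u :: real
      show "((\<lambda>s. f (x + s *\<^sub>R b)) has_derivative (\<lambda>v. f' (x + u *\<^sub>R b) (v *\<^sub>R b))) (at u within UNIV)"
        by (rule has_derivative_compose[OF _ d]) (auto intro!: derivative_eq_intros)
      show "onorm (\<lambda>v. f' (x + u *\<^sub>R b) (v *\<^sub>R b)) \<le> M"
      proof (rule onorm_le)
        fix v :: real
        have "f' (x + u *\<^sub>R b) (v *\<^sub>R b) = v *\<^sub>R f' (x + u *\<^sub>R b) b"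
          using has_derivative_bounded_linear[OF d] by (rule linear_simps)
        then show "norm (f' (x + u *\<^sub>R b) (v *\<^sub>R b)) \<le> M * norm v"
          using mult_right_mono[OF Mb[of "x + u *\<^sub>R b"], of "\<bar>v\<bar>"] by (simp add: mult.commute)
      qed
    qed auto
    then show ?thesis by simp
  qed
  have "(\<lambda>n. LINT x|lborel. q n x) \<longlonglongrightarrow> (LINT x|lborel. f' x b)"
  proof (rule integral_dominated_convergence)
    show "integrable lborel (\<lambda>x::'a. M * indicator (cball 0 (R + norm b)) x :: real)"
      using emeasure_compact_finite[OF compact_cball, of "0::'a" "R + norm b"]
      by (intro integrable_mult_right integrable_real_indicator) auto
    show "AE x in lborel. (\<lambda>n. q n x) \<longlonglongrightarrow> f' x b"
    proof (rule AE_I2)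
      fix x
      have "((\<lambda>s. f (x + s *\<^sub>R b)) has_derivative (\<lambda>v. f' (x + 0 *\<^sub>R b) (v *\<^sub>R b))) (at (0::real))"
        by (rule has_derivative_compose[OF _ d]) (auto intro!: derivative_eq_intros)
      also have "(\<lambda>v. f' (x + 0 *\<^sub>R b) (v *\<^sub>R b)) = (\<lambda>v. v *\<^sub>R f' x b)"
        using linear_simps(5)[OF has_derivative_bounded_linear[OF d]] by simp
      finally have "((\<lambda>s. norm (f (x + s *\<^sub>R b) - f x - s *\<^sub>R f' x b) / \<bar>s\<bar>) \<longlongrightarrow> 0) (at 0)"
        by (simp add: has_derivative_iff_norm)
      then have "((\<lambda>s. norm ((f (x + s *\<^sub>R b) - f x) /\<^sub>R s - f' x b)) \<longlongrightarrow> 0) (at 0)"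
      proof (rule Lim_transform_eventually)
        have "norm (f (x + s *\<^sub>R b) - f x - s *\<^sub>R f' x b) / \<bar>s\<bar> = norm ((f (x + s *\<^sub>R b) - f x) /\<^sub>R s - f' x b)"
          if "s \<noteq> 0" for s
        proof -
          have "(f (x + s *\<^sub>R b) - f x) /\<^sub>R s - f' x b = (f (x + s *\<^sub>R b) - f x - s *\<^sub>R f' x b) /\<^sub>R s"
            using that by (simp add: scaleR_diff_right)
          then show ?thesis by (simp add: divide_inverse mult.commute)
        qed
        then show "\<forall>\<^sub>F s in at 0. norm (f (x + s *\<^sub>R b) - f x - s *\<^sub>R f' x b) / \<bar>s\<bar> = norm ((f (x + s *\<^sub>R b) - f x) /\<^sub>R s - f' x b)"
          by (auto simp: eventually_at_filter)
      qed
      then have "((\<lambda>s. (f (x + s *\<^sub>R b) - f x) /\<^sub>R s) \<longlongrightarrow> f' x b) (at 0)"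
        by (simp only: tendsto_norm_zero_iff LIM_zero_iff)
      moreover have "filterlim h (at 0) sequentially"
        unfolding filterlim_at using LIMSEQ_inverse_real_of_nat h
        by (auto simp: h_def inverse_eq_divide)
      ultimately show "(\<lambda>n. q n x) \<longlonglongrightarrow> f' x b"
        unfolding q_def by (rule filterlim_compose)
    qed
    show "AE x in lborel. norm (q n x) \<le> M * indicator (cball 0 (R + norm b)) x" for n
    proof (rule AE_I2)
      fix x
      show "norm (q n x) \<le> M * indicator (cball 0 (R + norm b)) x"
      proof (cases "norm x \<le> R + norm b")
        case True
        have "norm (q n x) = norm (f (x + h n *\<^sub>R b) - f x) / h n"
          using h(1)[of n] unfolding q_def norm_scaleR by (simp add: divide_inverse mult.commute)
        also have "\<dots> \<le> M"
          using lip[of x "h n"] h(1)[of n] by (simp add: pos_divide_le_eq)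
        finally show ?thesis using True by simp
      next
        case False
        have "norm (h n *\<^sub>R b) \<le> norm b" using h[of n] by (simp add: mult_left_le_one_le)
        moreover have "norm x \<le> norm (x + h n *\<^sub>R b) + norm (h n *\<^sub>R b)"
          by (metis add_diff_cancel norm_triangle_ineq4)
        ultimately have "R \<le> norm (x + h n *\<^sub>R b)" "R \<le> norm x"
          using False norm_ge_zero[of b] by linarith+
        then show ?thesis using False by (simp add: q_def supp)
      qed
    qed
  qed (auto simp: q_def)
  then show ?thesis by (simp add: q0 LIMSEQ_const_iff)
qed

text \<open>
  Integration by parts: the integral of the derivative of \<open>cis (- (x \<bullet> \<xi>)) * f x\<close> is \<open>0\<close>.
\<close>
lemma fourier_partial_derivative:
  assumes f: "bump f" and D: "\<And>b. bump (D b)"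
    and d: "\<And>x. (f has_derivative (\<lambda>h. \<Sum>b\<in>Basis. complex_of_real (h \<bullet> b) * D b x)) (at x)"
    and b: "b \<in> Basis"
  shows "fourier (D b) \<xi> = \<i> * of_real (\<xi> \<bullet> b) * fourier f \<xi>"
proof -
  define G where "G = (\<lambda>x h. cis (- (x \<bullet> \<xi>)) * (\<Sum>b\<in>Basis. complex_of_real (h \<bullet> b) * D b x) + (- (h \<bullet> \<xi>)) *\<^sub>R (\<i> * cis (- (x \<bullet> \<xi>))) * f x)"
  have Gb: "G x b = cis (- (x \<bullet> \<xi>)) * D b x - (\<i> * of_real (\<xi> \<bullet> b)) * (cis (- (x \<bullet> \<xi>)) * f x)" for x
  proof -
    have "(\<Sum>c\<in>Basis. complex_of_real (b \<bullet> c) * D c x) = (\<Sum>c\<in>Basis. if b = c then D c x else 0)"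
      by (intro sum.cong) (use b in \<open>auto simp: inner_Basis\<close>)
    also have "\<dots> = D b x" using b by simp
    finally show ?thesis by (simp add: G_def scaleR_conv_of_real inner_commute)
  qed
  have "(LINT x|lborel. G x b) = 0"
  proof (rule integral_partial_derivative_eq_0[where R = 2 and f = "\<lambda>x. cis (- (x \<bullet> \<xi>)) * f x"])
    fix x
    have "((\<lambda>x. cis (- (x \<bullet> \<xi>))) has_derivative (\<lambda>h. (- (h \<bullet> \<xi>)) *\<^sub>R (\<i> * cis (- (x \<bullet> \<xi>))))) (at x)"
      by (rule has_derivative_cis) (auto intro!: derivative_eq_intros)
    from has_derivative_mult[OF this d]
    show "((\<lambda>x. cis (- (x \<bullet> \<xi>)) * f x) has_derivative G x) (at x)"
      unfolding G_def .
    show "cis (- (x \<bullet> \<xi>)) * f x = 0" if "2 \<le> norm x" using bump_support[OF f that] by simp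
    show "G x b = 0" if "2 \<le> norm x" using bump_support[OF f that] bump_support[OF D that] by (simp add: Gb)
  next
    show "continuous_on UNIV (\<lambda>x. G x b)"
      unfolding Gb by (intro continuous_intros bump_continuous f D)
  qed
  also have "(LINT x|lborel. G x b) = fourier (D b) \<xi> - (\<i> * of_real (\<xi> \<bullet> b)) * fourier f \<xi>"
    using bump_integrable[OF f] bump_integrable[OF D[of b]] 
    by (simp add: Gb fourier_lborel bump_measurable f D integrable_cis_mult)
  finally show ?thesis by simp
qed

lemma fourier_laplacian:
  fixes f :: "'a::euclidean_space \<Rightarrow> complex"
  assumes "bump f"
  shows "\<exists>g. bump g \<and> (\<forall>\<xi>. fourier g \<xi> = of_real (norm \<xi> ^ 2) * fourier f \<xi>)"
proof -
  have "\<exists>g. bump g \<and> (\<forall>\<xi>. fourier g \<xi> = of_real ((\<xi> \<bullet> b)\<^sup>2) * fourier f \<xi>)" if b: "b \<in> Basis" for b :: 'a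
  proof -
    obtain D where D: "\<And>b. bump (D b)" "\<And>x. (f has_derivative (\<lambda>h. \<Sum>b\<in>Basis. complex_of_real (h \<bullet> b) * D b x)) (at x)"
      using bump_has_derivative[OF assms] by blast
    obtain E where E: "\<And>c. bump (E c)" "\<And>x. (D b has_derivative (\<lambda>h. \<Sum>c\<in>Basis. complex_of_real (h \<bullet> c) * E c x)) (at x)"
      using bump_has_derivative[OF D(1)[of b]] by blast
    have "fourier (E b) \<xi> = - of_real ((\<xi> \<bullet> b)\<^sup>2) * fourier f \<xi>" for \<xi>
      by (simp add: fourier_partial_derivative[OF D(1) E b] fourier_partial_derivative[OF assms D b] power2_eq_square algebra_simps)
    moreover have "fourier (\<lambda>x. (- 1) * E b x) \<xi> = - fourier (E b) \<xi>" for \<xi>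
      by (simp add: fourier_def)
    ultimately show ?thesis using bump_cmult[OF E(1)[of b], of "- 1"] by (intro exI[of _ "\<lambda>x. (- 1) * E b x"]) auto
  qed
  then obtain g where g: "\<And>b. b \<in> Basis \<Longrightarrow> bump (g b)"
    "\<And>b \<xi>. b \<in> Basis \<Longrightarrow> fourier (g b) \<xi> = of_real ((\<xi> \<bullet> b)\<^sup>2) * fourier f \<xi>" by metis
  let ?g = "\<lambda>x. \<Sum>b\<in>Basis. g b x"
  have bg: "bump ?g" by (intro bump_sum g) auto
  have "fourier ?g \<xi> = of_real (norm \<xi> ^ 2) * fourier f \<xi>" for \<xi>
  proof -
    have "fourier ?g \<xi> = (\<Sum>b\<in>Basis. fourier (g b) \<xi>)"
      using g(1) by (simp add: fourier_lborel bump_measurable bg sum_distrib_left integrable_cis_mult bump_integrable)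
    also have "\<dots> = of_real (\<Sum>b\<in>Basis. (\<xi> \<bullet> b)\<^sup>2) * fourier f \<xi>"
      by (simp add: g(2) sum_distrib_right)
    also have "(\<Sum>b\<in>Basis. (\<xi> \<bullet> b)\<^sup>2) = norm \<xi> ^ 2"
      by (rule norm_sq_Basis[symmetric])
    finally show ?thesis .
  qed
  with bg show ?thesis by blast
qed

lemma fourier_laplacian_power:
  assumes "bump f"
  shows "\<exists>g. bump g \<and> (\<forall>\<xi>. fourier g \<xi> = of_real (norm \<xi> ^ (2 * m)) * fourier f \<xi>)"
proof (induction m)
  case 0
  show ?case using assms by (intro exI[of _ f]) simp
next
  case (Suc m)
  then obtain g where g: "bump g" "\<And>\<xi>. fourier g \<xi> = of_real (norm \<xi> ^ (2 * m)) * fourier f \<xi>" by blast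
  obtain h where h: "bump h" "\<And>\<xi>. fourier h \<xi> = of_real (norm \<xi> ^ 2) * fourier g \<xi>"
    using fourier_laplacian[OF g(1)] by blast
  show ?case by (rule exI[of _ h]) (simp add: h g(2) power2_eq_square mult_ac)
qed

text \<open>
  Multiplication by \<open>norm \<xi> ^ (2 * m)\<close> amounts to applying a power of the Laplacian, and Fourier
  transforms of integrable functions are bounded.
\<close>
lemma fourier_bump_decay:
  assumes "bump f"
  shows "\<exists>C\<ge>0. \<forall>\<xi>. norm (fourier f \<xi>) \<le> C * (1 + norm \<xi>) powr (- \<gamma>)"
proof -
  obtain m :: nat where m: "\<gamma> \<le> real (2 * m)"
    using real_arch_simple[of "\<gamma>"] by (metis of_nat_mono order.trans mult_2 le_add1)
  obtain g where g: "bump g" "\<And>\<xi>. fourier g \<xi> = of_real (norm \<xi> ^ (2 * m)) * fourier f \<xi>"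
    using fourier_laplacian_power[OF assms] by blast
  let ?A = "LINT x|lborel. norm (f x)" and ?B = "LINT x|lborel. norm (g x)"
  have "norm (fourier f \<xi>) \<le> (2 ^ (2 * m) * (?A + ?B)) * (1 + norm \<xi>) powr (- \<gamma>)" for \<xi>
  proof -
    let ?r = "norm \<xi>" and ?F = "norm (fourier f \<xi>)"
    have "?F * (1 + ?r) ^ (2 * m) \<le> ?F * (2 ^ (2 * m) * (1 + ?r ^ (2 * m)))"
    proof (intro mult_left_mono)
      have "(1 + ?r) ^ (2 * m) \<le> (2 * max 1 ?r) ^ (2 * m)" by (intro power_mono) auto
      also have "\<dots> = 2 ^ (2 * m) * max 1 ?r ^ (2 * m)" by (simp add: power_mult_distrib)
      also have "max 1 ?r ^ (2 * m) \<le> 1 + ?r ^ (2 * m)" by (auto simp: max_def)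
      finally show "(1 + ?r) ^ (2 * m) \<le> 2 ^ (2 * m) * (1 + ?r ^ (2 * m))" by simp
    qed simp
    also have "\<dots> = 2 ^ (2 * m) * (?F + norm (fourier g \<xi>))"
      by (simp add: g(2) norm_mult norm_power algebra_simps)
    also have "\<dots> \<le> 2 ^ (2 * m) * (?A + ?B)"
      by (intro mult_left_mono add_mono norm_fourier_le bump_integrable assms g) auto
    finally have *: "?F * (1 + ?r) ^ (2 * m) \<le> 2 ^ (2 * m) * (?A + ?B)" .
    have "?F * (1 + ?r) powr \<gamma> \<le> ?F * (1 + ?r) powr (real (2 * m))"
      using m by (intro mult_left_mono powr_mono) auto
    also have "\<dots> = ?F * (1 + ?r) ^ (2 * m)"
      by (subst powr_realpow) (auto simp: add_pos_nonneg)
    also note *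
    finally have "?F \<le> (2 ^ (2 * m) * (?A + ?B)) / (1 + ?r) powr \<gamma>"
      by (subst pos_le_divide_eq) (auto simp: add_nonneg_eq_0_iff)
    then show ?thesis by (simp only: powr_minus divide_inverse)
  qed
  moreover have "0 \<le> 2 ^ (2 * m) * (?A + ?B)" by (simp add: integral_nonneg_AE)
  ultimately show ?thesis by blast
qed

section \<open>The heat kernel\<close>

text \<open>
  A rescaling of the characteristic function of the standard normal distribution.
\<close>
lemma gaussian_fourier_real:
  fixes x t :: real assumes t: "0 < t"
  shows "integrable lborel (\<lambda>u. cis (x * u) * complex_of_real (exp (- (t * u\<^sup>2))))"
    and "(LINT u|lborel. cis (x * u) * complex_of_real (exp (- (t * u\<^sup>2)))) = complex_of_real (sqrt (pi / t) * exp (- (x\<^sup>2 / (4 * t))))"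
proof -
  define c where "c = sqrt (2 * t)"
  have c: "0 < c" "c\<^sup>2 = 2 * t" using t by (auto simp: c_def)
  let ?F = "\<lambda>v. complex_of_real (std_normal_density v) * cis (x / c * v)"
  have "integrable lborel std_normal_density"
    using integrable_normal_density[of 1 0] by simp
  then have F: "integrable lborel ?F"
    by (rule Bochner_Integration.integrable_bound) (auto simp: norm_mult)
  have "integral\<^sup>L lborel ?F = char std_normal_distribution (x / c)"
    unfolding char_def
    by (subst integral_density) (auto simp: normal_density_nonneg scaleR_conv_of_real cis_conv_exp)
  also have "\<dots> = complex_of_real (exp (- (x\<^sup>2 / (4 * t))))"
    by (simp add: char_std_normal_distribution power_divide c)
  finally have I: "integral\<^sup>L lborel ?F = complex_of_real (exp (- (x\<^sup>2 / (4 * t))))" .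
  have eq: "?F (0 + c * u) = complex_of_real (1 / sqrt (2 * pi)) * (cis (x * u) * complex_of_real (exp (- (t * u\<^sup>2))))" for u
    using c by (simp add: std_normal_density_def power_mult_distrib field_simps)
  show "integrable lborel (\<lambda>u. cis (x * u) * complex_of_real (exp (- (t * u\<^sup>2))))"
  proof -
    have "integrable lborel (\<lambda>u. complex_of_real (sqrt (2 * pi)) * ?F (0 + c * u))"
      using lborel_integrable_real_affine[OF F, of c 0] c(1) by (intro integrable_mult_right) simp
    then show ?thesis unfolding eq by simp
  qed
  have "complex_of_real (exp (- (x\<^sup>2 / (4 * t)))) = c *\<^sub>R (complex_of_real (1 / sqrt (2 * pi)) * (LINT u|lborel. cis (x * u) * complex_of_real (exp (- (t * u\<^sup>2)))))"
    using lborel_integral_real_affine[of c ?F 0] c(1) unfolding eq I by simp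
  then have "(LINT u|lborel. cis (x * u) * complex_of_real (exp (- (t * u\<^sup>2)))) = complex_of_real (sqrt (2 * pi) / c * exp (- (x\<^sup>2 / (4 * t))))"
    using c(1) by (simp add: scaleR_conv_of_real field_simps)
  also have "sqrt (2 * pi) / c = sqrt (pi / t)"
    by (simp add: c_def real_sqrt_divide[symmetric])
  finally show "(LINT u|lborel. cis (x * u) * complex_of_real (exp (- (t * u\<^sup>2)))) = complex_of_real (sqrt (pi / t) * exp (- (x\<^sup>2 / (4 * t))))" .
qed

lemma cis_sum: "finite A \<Longrightarrow> cis (\<Sum>a\<in>A. f a) = (\<Prod>a\<in>A. cis (f a))"
  by (induction A rule: finite_induct) (auto simp: cis_mult[symmetric])

text \<open>
  Both the Gaussian and the character \<open>cis (x \<bullet> \<xi>)\<close> are products over the coordinates, which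
  reduces the claim to one dimension.
\<close>
lemma gaussian_fourier:
  fixes x :: "'a::euclidean_space" assumes t: "0 < t"
  shows "integrable lborel (\<lambda>\<xi>. cis (x \<bullet> \<xi>) * complex_of_real (exp (- (t * (norm \<xi>)\<^sup>2))))"
    and "(LINT \<xi>|lborel. cis (x \<bullet> \<xi>) * complex_of_real (exp (- (t * (norm \<xi>)\<^sup>2)))) =
      complex_of_real ((pi / t) powr (real DIM('a) / 2) * exp (- ((norm x)\<^sup>2 / (4 * t))))"
proof -
  interpret product_sigma_finite "\<lambda>_::'a. lborel :: real measure" ..
  let ?F = "\<lambda>\<xi>::'a. cis (x \<bullet> \<xi>) * complex_of_real (exp (- (t * (norm \<xi>)\<^sup>2)))"
  let ?g = "\<lambda>b u. cis ((x \<bullet> b) * u) * complex_of_real (exp (- (t * u\<^sup>2)))"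
  let ?T = "\<lambda>f. \<Sum>b\<in>(Basis::'a set). f b *\<^sub>R b"
  have [measurable]: "?F \<in> borel_measurable borel" by measurable
  have T[measurable]: "?T \<in> measurable (Pi\<^sub>M Basis (\<lambda>b. lborel)) borel" by measurable
  have eq: "?F (?T f) = (\<Prod>b\<in>Basis. ?g b (f b))" for f
  proof -
    have Tb: "?T f \<bullet> b = f b" if "b \<in> Basis" for b using that by simp
    have "x \<bullet> ?T f = (\<Sum>b\<in>Basis. (x \<bullet> b) * f b)"
      by (subst euclidean_inner) (simp add: Tb)
    moreover have "(norm (?T f))\<^sup>2 = (\<Sum>b\<in>Basis. (f b)\<^sup>2)"
      by (subst norm_sq_Basis) (simp add: Tb)
    ultimately show ?thesis
      by (simp only: cis_sum[OF finite_Basis] prod.distrib of_real_prod[symmetric] exp_sum[OF finite_Basis, symmetric] sum_distrib_left sum_negf)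
  qed
  have int: "integrable (Pi\<^sub>M Basis (\<lambda>b. lborel)) (\<lambda>f. \<Prod>b\<in>Basis. ?g b (f b))"
    by (intro product_integrable_prod gaussian_fourier_real(1) t) auto
  show "integrable lborel ?F"
    by (subst lborel_eq, subst integrable_distr_eq) (simp_all only: T eq int, measurable)
  have "integral\<^sup>L lborel ?F = integral\<^sup>L (Pi\<^sub>M Basis (\<lambda>b. lborel)) (\<lambda>f. \<Prod>b\<in>Basis. ?g b (f b))"
    by (subst lborel_eq, subst integral_distr) (simp_all only: T eq, measurable)
  also have "\<dots> = (\<Prod>b\<in>Basis. integral\<^sup>L lborel (?g b))"
    by (intro product_integral_prod gaussian_fourier_real(1) t) auto
  also have "\<dots> = complex_of_real (\<Prod>b\<in>(Basis::'a set). sqrt (pi / t) * exp (- ((x \<bullet> b)\<^sup>2 / (4 * t))))"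
    by (simp only: gaussian_fourier_real(2)[OF t] of_real_prod)
  also have "(\<Prod>b\<in>(Basis::'a set). sqrt (pi / t) * exp (- ((x \<bullet> b)\<^sup>2 / (4 * t)))) = sqrt (pi / t) ^ DIM('a) * exp (- ((norm x)\<^sup>2 / (4 * t)))"
    by (simp add: prod.distrib exp_sum[symmetric] norm_sq_Basis sum_divide_distrib sum_negf)
  also have "sqrt (pi / t) ^ DIM('a) = (pi / t) powr (real DIM('a) / 2)"
    using t by (simp add: powr_half_sqrt[symmetric] powr_realpow[symmetric] powr_powr)
  finally show "integral\<^sup>L lborel ?F = complex_of_real ((pi / t) powr (real DIM('a) / 2) * exp (- ((norm x)\<^sup>2 / (4 * t))))" .
qed

lemma gaussian_integrable:
  "0 < t \<Longrightarrow> integrable lborel (\<lambda>\<xi>::'a::euclidean_space. exp (- (t * (norm \<xi>)\<^sup>2)) :: real)"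
  using integrable_norm[OF gaussian_fourier(1)[of t "0::'a"]] by simp

text \<open>
  On the Fourier side, the Gaussian factor is convolution with the heat kernel.
\<close>
lemma inverse_fourier_heat:
  fixes f :: "'a::euclidean_space \<Rightarrow> complex"
  assumes f: "integrable lborel f" and t: "0 < t"
  shows "(LINT \<xi>|lborel. cis (x \<bullet> \<xi>) * (complex_of_real (exp (- (t * (norm \<xi>)\<^sup>2))) * fourier f \<xi>)) =
    (LINT y|lborel. f y * complex_of_real ((pi / t) powr (real DIM('a) / 2) * exp (- ((norm (x - y))\<^sup>2 / (4 * t)))))"
proof -
  have [measurable]: "f \<in> borel_measurable borel" using f by auto
  let ?G = "\<lambda>\<xi> y. cis (x \<bullet> \<xi>) * (complex_of_real (exp (- (t * (norm \<xi>)\<^sup>2))) * (cis (- (y \<bullet> \<xi>)) * f y))"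
  have i: "integrable lborel (\<lambda>y. ?G \<xi> y)" for \<xi>
    by (intro integrable_mult_right integrable_cis_mult f) measurable
  have "integrable (lborel \<Otimes>\<^sub>M lborel) (\<lambda>(\<xi>, y). ?G \<xi> y)"
  proof (rule lborel_pair.Fubini_integrable)
    have "(\<lambda>\<xi>. LINT y|lborel. norm (?G \<xi> y)) = (\<lambda>\<xi>. exp (- (t * (norm \<xi>)\<^sup>2)) * (LINT y|lborel. norm (f y)))"
      by (simp add: norm_mult)
    then show "integrable lborel (\<lambda>\<xi>. LINT y|lborel. norm (case (\<xi>, y) of (\<xi>, y) \<Rightarrow> ?G \<xi> y))"
      using gaussian_integrable[OF t, where 'a='a] by simp
    show "AE \<xi> in lborel. integrable lborel (\<lambda>y. case (\<xi>, y) of (\<xi>, y) \<Rightarrow> ?G \<xi> y)"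
      using i by simp
  qed measurable
  from lborel_pair.Fubini_integral[OF this]
  have "(LINT \<xi>|lborel. LINT y|lborel. ?G \<xi> y) = (LINT y|lborel. LINT \<xi>|lborel. ?G \<xi> y)" by simp
  moreover have "(LINT y|lborel. ?G \<xi> y) = cis (x \<bullet> \<xi>) * (complex_of_real (exp (- (t * (norm \<xi>)\<^sup>2))) * fourier f \<xi>)" for \<xi>
    by (simp add: fourier_lborel)
  moreover have "(LINT \<xi>|lborel. ?G \<xi> y) = f y * complex_of_real ((pi / t) powr (real DIM('a) / 2) * exp (- ((norm (x - y))\<^sup>2 / (4 * t))))" for y
  proof -
    have "?G \<xi> y = f y * (cis ((x - y) \<bullet> \<xi>) * complex_of_real (exp (- (t * (norm \<xi>)\<^sup>2))))" for \<xi>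
    proof -
      have "cis ((x - y) \<bullet> \<xi>) = cis (x \<bullet> \<xi>) * cis (- (y \<bullet> \<xi>))"
        by (simp add: cis_mult inner_diff_left)
      then show ?thesis by (simp add: mult_ac)
    qed
    then have "(LINT \<xi>|lborel. ?G \<xi> y) = f y * (LINT \<xi>|lborel. cis ((x - y) \<bullet> \<xi>) * complex_of_real (exp (- (t * (norm \<xi>)\<^sup>2))))"
      by (simp only: integral_mult_right_zero)
    then show ?thesis by (simp only: gaussian_fourier(2)[OF t])
  qed
  ultimately show ?thesis by simp
qed

text \<open>
  The function \<open>f\<close> is smoothed by the heat kernel at time \<open>t\<close>. Since \<open>f\<close> lives in the ball of radius \<open>2\<close> and
  \<open>norm x \<ge> 4\<close>, all \<open>y\<close> that matter satisfy \<open>norm (x - y) \<ge> norm x / 2\<close>.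
\<close>
lemma inverse_fourier_heat_bound:
  fixes f :: "'a::euclidean_space \<Rightarrow> complex"
  assumes f: "bump f" and t: "0 < t" and x: "4 \<le> norm x"
  shows "norm (LINT \<xi>|lborel. cis (x \<bullet> \<xi>) * (complex_of_real (exp (- (t * (norm \<xi>)\<^sup>2))) * fourier f \<xi>))
    \<le> (LINT y|lborel. norm (f y)) * ((pi / t) powr (real DIM('a) / 2) * exp (- ((norm x)\<^sup>2 / (16 * t))))"
proof -
  have [measurable]: "f \<in> borel_measurable borel" using f by (rule bump_measurable)
  let ?c = "(pi / t) powr (real DIM('a) / 2)"
  let ?G = "\<lambda>y. f y * complex_of_real (?c * exp (- ((norm (x - y))\<^sup>2 / (4 * t))))"
  have le: "norm (?G y) \<le> norm (f y) * (?c * exp (- ((norm x)\<^sup>2 / (16 * t))))" for y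
  proof (cases "f y = 0")
    case False
    then have "norm y < 2" using bump_support[OF f, of y] by (meson not_le)
    then have "norm x / 2 \<le> norm (x - y)" using x norm_triangle_ineq2[of x y] by linarith
    then have "(norm x / 2)\<^sup>2 \<le> (norm (x - y))\<^sup>2" by (intro power_mono) auto
    then have "(norm x)\<^sup>2 / (16 * t) \<le> (norm (x - y))\<^sup>2 / (4 * t)"
      using t by (simp add: field_simps power_divide)
    then show ?thesis by (auto simp: norm_mult intro!: mult_left_mono)
  qed simp
  have "norm (LINT y|lborel. ?G y) \<le> (LINT y|lborel. norm (f y) * (?c * exp (- ((norm x)\<^sup>2 / (16 * t)))))"
  proof (rule Bochner_Integration.integral_norm_bound_integral)
    show i: "integrable lborel (\<lambda>y. norm (f y) * (?c * exp (- ((norm x)\<^sup>2 / (16 * t)))))"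
      using bump_integrable[OF f] by simp
    show "integrable lborel ?G"
      by (rule Bochner_Integration.integrable_bound[OF i]) (use le in \<open>auto intro: order.trans[OF _ abs_ge_self]\<close>)
  qed (use le in auto)
  then show ?thesis
    unfolding inverse_fourier_heat[OF bump_integrable[OF f] t] by simp
qed

section \<open>Dyadic decomposition and Fourier inversion off the support\<close>

text \<open>
  The factor \<open>(1 + norm (x - x0) / s) powr (- \<gamma>)\<close> is dominated by a sum over the dyadic balls of radius
  \<open>s * 2 ^ Suc k\<close> with coefficients \<open>2 powr (- \<gamma> * k)\<close>, and growth of order \<open>D < \<gamma>\<close> leaves a geometric
  series. The constant depends on \<open>\<gamma>\<close> and \<open>D\<close> only, which is what makes the final estimate uniform in the
  centre and the radius. The same lemma with \<open>w = 1\<close> gives integrability of polynomially decaying functions.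
\<close>
lemma dyadic_tail_bound:
  fixes \<gamma> D :: real
  assumes "D < \<gamma>" "0 \<le> D"
  shows "\<exists>C>0. \<forall>(w::'a::euclidean_space \<Rightarrow> real) x0 s A. w \<in> borel_measurable lebesgue \<longrightarrow> 0 < s \<longrightarrow> 0 \<le> A \<longrightarrow>
     (\<forall>t\<ge>s. weighted_measure w (ball x0 t) \<le> ennreal (A * t powr D)) \<longrightarrow>
     (\<integral>\<^sup>+x. ennreal ((1 + norm (x - x0) / s) powr (- \<gamma>) * w x) \<partial>lebesgue) \<le> ennreal (C * A * s powr D)"
proof -
  define q where "q = 2 powr (D - \<gamma>)"
  have q: "0 < q" "q < 1" using assms by (auto simp: q_def powr_less_one)
  define C where "C = 2 powr D * (1 / (1 - q))"
  have "(\<integral>\<^sup>+x. ennreal ((1 + norm (x - x0) / s) powr (- \<gamma>) * w x) \<partial>lebesgue) \<le> ennreal (C * A * s powr D)"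
    if w[measurable]: "w \<in> borel_measurable lebesgue" and s: "0 < s" and A: "0 \<le> A"
      and bd: "\<And>t. s \<le> t \<Longrightarrow> weighted_measure w (ball x0 t) \<le> ennreal (A * t powr D)"
    for w :: "'a \<Rightarrow> real" and x0 s A
  proof -
    let ?B = "\<lambda>k::nat. ball x0 (s * 2 ^ Suc k)"
    let ?c = "\<lambda>k::nat. 2 powr (- (\<gamma> * k))"
    have [measurable]: "?B k \<in> sets lebesgue" for k by simp
    have pw: "ennreal ((1 + norm (x - x0) / s) powr (- \<gamma>) * w x) \<le> (\<Sum>k. ennreal (?c k) * (ennreal (w x) * indicator (?B k) x))" for x
    proof (cases "0 \<le> w x")
      case True
      define r where "r = 1 + norm (x - x0) / s"
      have r1: "1 \<le> r" using s by (simp add: r_def)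
      define k where "k = nat \<lfloor>log 2 r\<rfloor>"
      have lg: "0 \<le> log 2 r" using r1 by simp
      have "real k = of_int \<lfloor>log 2 r\<rfloor>" using lg by (simp add: k_def)
      then have k: "real k \<le> log 2 r" "log 2 r < real (Suc k)" by linarith+
      have "2 powr real k \<le> r" using k r1 by (simp add: le_log_iff)
      moreover have "r < 2 powr real (Suc k)" using k r1 by (simp add: log_less_iff)
      ultimately have kr: "2 powr real k \<le> r" "r < 2 ^ Suc k" by (simp_all only: powr_realpow zero_less_numeral)
      have "r powr (- \<gamma>) \<le> (2 powr real k) powr (- \<gamma>)"
        using kr r1 assms by (intro powr_mono2') auto
      also have "\<dots> = ?c k" by (simp add: powr_powr mult.commute)
      finally have rc: "r powr (- \<gamma>) \<le> ?c k" .
      have "norm (x - x0) / s < 2 ^ Suc k" using kr(2) by (simp add: r_def)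
      then have "x \<in> ?B k" using s by (simp add: dist_norm norm_minus_commute pos_divide_less_eq mult.commute)
      then have "ennreal (r powr (- \<gamma>) * w x) \<le> ennreal (?c k) * (ennreal (w x) * indicator (?B k) x)"
        using rc True by (simp add: ennreal_mult''[symmetric] mult_right_mono ennreal_leI)
      also have "\<dots> \<le> (\<Sum>k. ennreal (?c k) * (ennreal (w x) * indicator (?B k) x))"
        using sum_le_suminf[of "\<lambda>k. ennreal (?c k) * (ennreal (w x) * indicator (?B k) x)" "{k}"] by simp
      finally show ?thesis by (simp add: r_def)
    qed (simp add: mult_nonneg_nonpos ennreal_neg)
    have term_le: "(\<integral>\<^sup>+x. ennreal (?c k) * (ennreal (w x) * indicator (?B k) x) \<partial>lebesgue) \<le> ennreal (2 powr D * A * s powr D * q ^ k)" for k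
    proof -
      have "(\<integral>\<^sup>+x. ennreal (?c k) * (ennreal (w x) * indicator (?B k) x) \<partial>lebesgue) = ennreal (?c k) * weighted_measure w (?B k)"
        unfolding weighted_measure_def by (intro nn_integral_cmult) measurable
      also have "\<dots> \<le> ennreal (?c k) * ennreal (A * (s * 2 ^ Suc k) powr D)"
        using s by (intro mult_left_mono bd) (simp_all add: mult_le_cancel_left1 one_le_power del: power_Suc)
      also have "\<dots> = ennreal (?c k * (A * (s * 2 ^ Suc k) powr D))" using A by (simp add: ennreal_mult'')
      also have "?c k * (A * (s * 2 ^ Suc k) powr D) = 2 powr D * A * s powr D * q ^ k"
      proof -
        have "(s * 2 ^ Suc k) powr D = s powr D * (2 powr D * 2 powr (D * k))"
          using s by (simp add: powr_mult powr_realpow[symmetric] powr_powr powr_add[symmetric] algebra_simps del: powr_realpow)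
        moreover have "?c k * 2 powr (D * k) = q ^ k"
          by (simp add: q_def powr_realpow[symmetric] powr_powr powr_add[symmetric] algebra_simps)
        ultimately show ?thesis by (simp add: mult_ac) 
      qed
      finally show ?thesis .
    qed
    have "(\<integral>\<^sup>+x. ennreal ((1 + norm (x - x0) / s) powr (- \<gamma>) * w x) \<partial>lebesgue)
       \<le> (\<integral>\<^sup>+x. (\<Sum>k. ennreal (?c k) * (ennreal (w x) * indicator (?B k) x)) \<partial>lebesgue)"
      by (intro nn_integral_mono pw)
    also have "\<dots> = (\<Sum>k. \<integral>\<^sup>+x. ennreal (?c k) * (ennreal (w x) * indicator (?B k) x) \<partial>lebesgue)"
      by (intro nn_integral_suminf) measurable
    also have "\<dots> \<le> (\<Sum>k. ennreal (2 powr D * A * s powr D * q ^ k))"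
      by (intro suminf_le term_le) auto
    also have "\<dots> = ennreal (\<Sum>k. 2 powr D * A * s powr D * q ^ k)"
      using A q by (intro suminf_ennreal2) (auto intro!: summable_mult summable_geometric)
    also have "(\<Sum>k. 2 powr D * A * s powr D * q ^ k) = C * A * s powr D"
      using q by (subst suminf_mult) (auto simp: suminf_geometric C_def intro!: summable_geometric)
    finally show ?thesis .
  qed
  moreover have "0 < C" using q by (simp add: C_def)
  ultimately show ?thesis by blast
qed

lemma integrable_polynomial_decay:
  assumes "real DIM('a) < \<gamma>"
  shows "integrable lborel (\<lambda>\<xi>::'a::euclidean_space. (1 + norm \<xi>) powr (- \<gamma>))"
proof (rule integrableI_nonneg)
  obtain C where C: "\<forall>(w::'a \<Rightarrow> real) x0 s A. w \<in> borel_measurable lebesgue \<longrightarrow> 0 < s \<longrightarrow> 0 \<le> A \<longrightarrow>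
     (\<forall>t\<ge>s. weighted_measure w (ball x0 t) \<le> ennreal (A * t powr real DIM('a))) \<longrightarrow>
     (\<integral>\<^sup>+x. ennreal ((1 + norm (x - x0) / s) powr (- \<gamma>) * w x) \<partial>lebesgue) \<le> ennreal (C * A * s powr real DIM('a))"
    using dyadic_tail_bound[OF assms of_nat_0_le_iff, where 'a='a] by blast
  have "weighted_measure (\<lambda>_. 1) (ball (0::'a) t) \<le> ennreal (unit_ball_vol (real DIM('a)) * t powr real DIM('a))" if "1 \<le> t" for t
    using that by (simp add: weighted_measure_def emeasure_ball powr_realpow)
  then have "nn_integral lebesgue (\<lambda>x::'a. ennreal ((1 + norm x) powr (- \<gamma>))) \<le> ennreal (C * unit_ball_vol (real DIM('a)))"
    using C[rule_format, of "\<lambda>_. 1" 1 "unit_ball_vol (real DIM('a))" 0] by (simp add: unit_ball_vol_nonneg)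
  then show "nn_integral lborel (\<lambda>x::'a. ennreal ((1 + norm x) powr (- \<gamma>))) < \<infinity>"
    by (simp add: nn_integral_completion le_less_trans)
qed auto

lemma integrable_powr_fourier:
  fixes f :: "'a::euclidean_space \<Rightarrow> complex"
  assumes f: "bump f" and a: "0 \<le> a"
  shows "integrable lborel (\<lambda>\<xi>. norm \<xi> powr a * norm (fourier f \<xi>))"
proof -
  obtain C where C: "0 \<le> C" "\<And>\<xi>. norm (fourier f \<xi>) \<le> C * (1 + norm \<xi>) powr (- (a + DIM('a) + 1))"
    using fourier_bump_decay[OF f] by blast
  have [measurable]: "f \<in> borel_measurable borel" using f by (rule bump_measurable)
  have i: "integrable lborel (\<lambda>\<xi>::'a. C * (1 + norm \<xi>) powr (- (real DIM('a) + 1)))"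
    using integrable_polynomial_decay[where 'a='a, of "real DIM('a) + 1"] by simp
  show ?thesis
  proof (rule Bochner_Integration.integrable_bound[OF i])
    show "AE \<xi> in lborel. norm (norm \<xi> powr a * norm (fourier f \<xi>)) \<le> norm (C * (1 + norm \<xi>) powr (- (real DIM('a) + 1)))"
    proof (rule AE_I2)
      fix \<xi> :: 'a
      have "norm \<xi> powr a * norm (fourier f \<xi>) \<le> (1 + norm \<xi>) powr a * (C * (1 + norm \<xi>) powr (- (a + DIM('a) + 1)))"
        using a by (intro mult_mono C powr_mono2) auto
      also have "\<dots> = C * (1 + norm \<xi>) powr (- (real DIM('a) + 1))"
        by (simp add: powr_add[symmetric] mult.left_commute)
      finally show "norm (norm \<xi> powr a * norm (fourier f \<xi>)) \<le> norm (C * (1 + norm \<xi>) powr (- (real DIM('a) + 1)))"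
        using C(1) by simp
    qed
  qed measurable
qed

lemma fourier_bump_integrable: "bump f \<Longrightarrow> integrable lborel (fourier f)"
proof -
  assume f: "bump f"
  have [measurable]: "f \<in> borel_measurable borel" using f by (rule bump_measurable)
  have "AE \<xi> in lborel. norm (fourier f \<xi>) \<le> norm (norm \<xi> powr 0 * norm (fourier f \<xi>))"
    using AE_lborel_singleton[of 0] by eventually_elim simp
  then show ?thesis
    by (intro Bochner_Integration.integrable_bound[OF integrable_powr_fourier[OF f, of 0]]) auto
qed

text \<open>
  Fourier inversion at points where \<open>f\<close> vanishes: regularise with \<open>exp (- t * norm \<xi> ^ 2)\<close> and let \<open>t\<close> tend
  to \<open>0\<close>; the smoothed function at \<open>x\<close> is of size \<open>exp (- c / t)\<close> up to powers of \<open>t\<close>.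
\<close>
lemma fourier_inversion_outside_support:
  fixes f :: "'a::euclidean_space \<Rightarrow> complex"
  assumes f: "bump f" and x: "4 \<le> norm x"
  shows "(LINT \<xi>|lborel. cis (x \<bullet> \<xi>) * fourier f \<xi>) = 0"
proof -
  have [measurable]: "f \<in> borel_measurable borel" using f by (rule bump_measurable)
  let ?H = "\<lambda>t. LINT \<xi>|lborel. cis (x \<bullet> \<xi>) * (complex_of_real (exp (- (1 / t * (norm \<xi>)\<^sup>2))) * fourier f \<xi>)"
  let ?M = "LINT y|lborel. norm (f y)"
  have "(?H \<longlongrightarrow> (LINT \<xi>|lborel. cis (x \<bullet> \<xi>) * fourier f \<xi>)) at_top"
  proof (rule integral_dominated_convergence_at_top[where w = "\<lambda>\<xi>. norm (fourier f \<xi>)"])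
    show "integrable lborel (\<lambda>\<xi>. norm (fourier f \<xi>))" using fourier_bump_integrable[OF f] by simp
    have "((\<lambda>t. cis (x \<bullet> \<xi>) * (complex_of_real (exp (- (1 / t * (norm \<xi>)\<^sup>2))) * fourier f \<xi>)) \<longlongrightarrow> cis (x \<bullet> \<xi>) * (complex_of_real (exp (- (0 * (norm \<xi>)\<^sup>2))) * fourier f \<xi>)) at_top" for \<xi>
      by (intro tendsto_intros tendsto_divide_0[OF tendsto_const] filterlim_at_top_imp_at_infinity filterlim_ident)
    then show "AE \<xi> in lborel. ((\<lambda>t. cis (x \<bullet> \<xi>) * (complex_of_real (exp (- (1 / t * (norm \<xi>)\<^sup>2))) * fourier f \<xi>)) \<longlongrightarrow> cis (x \<bullet> \<xi>) * fourier f \<xi>) at_top"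
      by simp
    show "\<forall>\<^sub>F t in at_top. AE \<xi> in lborel. norm (cis (x \<bullet> \<xi>) * (complex_of_real (exp (- (1 / t * (norm \<xi>)\<^sup>2))) * fourier f \<xi>)) \<le> norm (fourier f \<xi>)"
      using eventually_gt_at_top[of 0]
      by eventually_elim (auto simp: norm_mult intro!: mult_left_le_one_le)
  qed measurable
  moreover have "(?H \<longlongrightarrow> 0) at_top"
  proof (rule Lim_null_comparison)
    show "\<forall>\<^sub>F t in at_top. norm (?H t) \<le> ?M * ((pi * t) powr (real DIM('a) / 2) * exp (- ((norm x)\<^sup>2 / 16 * t)))"
      using eventually_gt_at_top[of 0]
    proof eventually_elim
      case (elim t)
      then show ?case using inverse_fourier_heat_bound[OF f _ x, of "1 / t"] by simp
    qed
    have c: "0 < (norm x)\<^sup>2 / 16" using x by (cases "x = 0") auto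
    have "((\<lambda>t. (pi * t) powr a * exp (- (c * t))) \<longlongrightarrow> 0) at_top" if "0 < c" for a c :: real
      using that by real_asymp
    from tendsto_mult_right_zero[OF this[OF c]]
    show "((\<lambda>t. ?M * ((pi * t) powr (real DIM('a) / 2) * exp (- ((norm x)\<^sup>2 / 16 * t)))) \<longlongrightarrow> 0) at_top" .
  qed
  ultimately show ?thesis by (rule tendsto_unique[OF trivial_limit_at_top_linorder])
qed

section \<open>Decay of the fractional Laplacian of a bump function\<close>

lemma power_le_fact_exp: "0 \<le> u \<Longrightarrow> u ^ k \<le> fact k * exp (u::real)"
proof -
  assume u: "0 \<le> u"
  have "(\<Sum>n\<in>{k}. u ^ n /\<^sub>R fact n) \<le> (\<Sum>n. u ^ n /\<^sub>R fact n)"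
    using u by (intro sum_le_suminf summable_exp_generic) auto
  then show ?thesis by (simp add: exp_def field_simps)
qed

lemma nn_integral_powr_min_finite:
  fixes c k :: real
  assumes "0 < c" "c < k"
  shows "(\<integral>\<^sup>+t. ennreal (t powr (- 1 - c) * min 1 (t powr k)) * indicator {0<..} t \<partial>lborel) < \<infinity>"
proof -
  have "(\<integral>\<^sup>+t. ennreal (t powr (- 1 - c) * min 1 (t powr k)) * indicator {0<..} t \<partial>lborel)
     \<le> (\<integral>\<^sup>+t. ennreal (indicator {0..1} t * t powr (k - 1 - c)) + ennreal (indicator {1..} t * t powr (- 1 - c)) \<partial>lborel)"
  proof (intro nn_integral_mono)
    fix t :: real
    have "t powr (- 1 - c) * min 1 (t powr k) \<le> indicator {0..1} t * t powr (k - 1 - c) + indicator {1..} t * t powr (- 1 - c)" if t: "0 < t"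
    proof (cases "t < 1")
      case True
      have "t powr (- 1 - c) * min 1 (t powr k) \<le> t powr (- 1 - c) * t powr k" by (intro mult_left_mono) auto
      also have "\<dots> = t powr (k - 1 - c)" by (simp add: powr_add[symmetric] algebra_simps)
      finally show ?thesis using True t by simp
    next
      case False
      have "t powr (- 1 - c) * min 1 (t powr k) \<le> t powr (- 1 - c) * 1" by (intro mult_left_mono) auto
      with False t show ?thesis by (auto split: split_indicator intro: order.trans)
    qed
    then show "ennreal (t powr (- 1 - c) * min 1 (t powr k)) * indicator {0<..} t
      \<le> ennreal (indicator {0..1} t * t powr (k - 1 - c)) + ennreal (indicator {1..} t * t powr (- 1 - c))"
      by (auto split: split_indicator simp flip: ennreal_plus intro!: ennreal_leI)
  qed
  also have "\<dots> = (\<integral>\<^sup>+t. ennreal (indicator {0..1} t * t powr (k - 1 - c)) \<partial>lborel) + (\<integral>\<^sup>+t. ennreal (indicator {1..} t * t powr (- 1 - c)) \<partial>lborel)"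
    by (rule nn_integral_add) auto
  also have "(\<integral>\<^sup>+t. ennreal (indicator {0..1} t * t powr (k - 1 - c)) \<partial>lborel) = ennreal (1 powr (k - 1 - c + 1) / (k - 1 - c + 1))"
    using assms by (intro nn_integral_has_integral_lebesgue has_integral_powr_from_0) auto
  also have "(\<integral>\<^sup>+t. ennreal (indicator {1..} t * t powr (- 1 - c)) \<partial>lborel) = ennreal (- (1 powr (- 1 - c + 1)) / (- 1 - c + 1))"
    using assms by (intro nn_integral_has_integral_lebesgue has_integral_powr_to_inf) auto
  finally show ?thesis by (rule le_less_trans) simp
qed

text \<open>
  The measure \<open>dt / t\<close> is invariant under dilations of the half-line.
\<close>
lemma nn_integral_powr_scale:
  fixes c l :: real
  assumes [measurable]: "h \<in> borel_measurable borel" and l: "0 < l"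
  shows "(\<integral>\<^sup>+t. ennreal (t powr (- 1 - c) * h (l * t)) * indicator {0<..} t \<partial>lborel) =
    ennreal (l powr c) * (\<integral>\<^sup>+t. ennreal (t powr (- 1 - c) * h t) * indicator {0<..} t \<partial>lborel)"
proof -
  have "ennreal (l powr c) * (\<integral>\<^sup>+t. ennreal (t powr (- 1 - c) * h t) * indicator {0<..} t \<partial>lborel)
     = ennreal (l powr c) * (ennreal l * (\<integral>\<^sup>+t. ennreal ((l * t) powr (- 1 - c) * h (l * t)) * indicator {0<..} (l * t) \<partial>lborel))"
    using l by (subst nn_integral_real_affine[where c = l and t = 0]) auto
  also have "\<dots> = (\<integral>\<^sup>+t. ennreal (l powr c) * (ennreal l * (ennreal ((l * t) powr (- 1 - c) * h (l * t)) * indicator {0<..} (l * t))) \<partial>lborel)"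
    by (simp add: nn_integral_cmult)
  also have "\<dots> = (\<integral>\<^sup>+t. ennreal (t powr (- 1 - c) * h (l * t)) * indicator {0<..} t \<partial>lborel)"
  proof (intro nn_integral_cong)
    fix t :: real
    have *: "l powr c * (l * ((l * t) powr (- 1 - c) * h (l * t))) = t powr (- 1 - c) * h (l * t)" if "0 < t"
    proof -
      have "l powr c * (l * l powr (- 1 - c)) = l powr c * (l powr 1 * l powr (- 1 - c))" using l by simp
      also have "\<dots> = 1" using l by (simp only: powr_add[symmetric]) simp
      finally have "l powr c * (l * l powr (- 1 - c)) = 1" .
      then show ?thesis using l that by (simp add: powr_mult mult_ac)
    qed
    show "ennreal (l powr c) * (ennreal l * (ennreal ((l * t) powr (- 1 - c) * h (l * t)) * indicator {0<..} (l * t)))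
        = ennreal (t powr (- 1 - c) * h (l * t)) * indicator {0<..} t"
    proof (cases "0 < t")
      case True
      then have ind: "indicator {0<..} (l * t) = (1::ennreal)" "indicator {0<..} t = (1::ennreal)" using l by auto
      show ?thesis
        unfolding ind mult_1_right *[OF True, symmetric] using l by (simp only: ennreal_mult' powr_ge_zero less_imp_le)
    qed (use l in \<open>simp add: zero_less_mult_iff\<close>)
  qed
  finally show ?thesis by simp
qed

text \<open>
  After dilation by \<open>s\<close>, the integral of \<open>(1 - exp (- s * t)) * t powr (- 1 - a / 2)\<close> is \<open>s powr (a / 2)\<close>
  times its value at \<open>s = 1\<close>. That value is finite because the integrand behaves like \<open>t powr (- a / 2)\<close>
  at \<open>0\<close>, where \<open>a < 2\<close>, and like \<open>t powr (- 1 - a / 2)\<close> at infinity, where \<open>a > 0\<close>.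
\<close>
lemma powr_subordination:
  fixes a :: real
  assumes a: "0 < a" "a < 2"
  shows "\<exists>c>0. \<forall>s\<ge>0. has_bochner_integral lborel
     (\<lambda>t. indicator {0<..} t * (t powr (- 1 - a / 2) * (1 - exp (- (s * t))))) (c * s powr (a / 2))"
proof -
  define J where "J = (\<integral>\<^sup>+t. ennreal (t powr (- 1 - a / 2) * (1 - exp (- t))) * indicator {0<..} t \<partial>lborel)"
  have "J \<le> (\<integral>\<^sup>+t. ennreal (t powr (- 1 - a / 2) * min 1 (t powr 1)) * indicator {0<..} t \<partial>lborel)"
    unfolding J_def
  proof (intro nn_integral_mono)
    fix t :: real
    show "ennreal (t powr (- 1 - a / 2) * (1 - exp (- t))) * indicator {0<..} t
      \<le> ennreal (t powr (- 1 - a / 2) * min 1 (t powr 1)) * indicator {0<..} t"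
      using exp_ge_add_one_self[of "- t"]
      by (auto split: split_indicator intro!: ennreal_leI mult_left_mono)
  qed
  also have "\<dots> < \<infinity>" using a by (intro nn_integral_powr_min_finite) auto
  finally have Jfin: "J < \<infinity>" .
  have "J \<noteq> 0"
  proof
    assume "J = 0"
    then have "AE t in lborel. ennreal (t powr (- 1 - a / 2) * (1 - exp (- t))) * indicator {0<..} t = 0"
      unfolding J_def by (subst (asm) nn_integral_0_iff_AE) auto
    then have "AE t in lborel. t \<in> {0<..1::real} \<longrightarrow> False"
      by eventually_elim (auto simp: mult_le_0_iff split: split_indicator_asm)
    from nonnegligible_AE_witness[OF this] show False by auto
  qed
  define c where "c = enn2real J"
  have c: "0 < c" "J = ennreal c" using Jfin \<open>J \<noteq> 0\<close> by (auto simp: c_def enn2real_positive_iff zero_less_iff_neq_zero)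
  have "has_bochner_integral lborel (\<lambda>t. indicator {0<..} t * (t powr (- 1 - a / 2) * (1 - exp (- (s * t))))) (c * s powr (a / 2))"
    if s: "0 \<le> s" for s
  proof (cases "s = 0")
    case False
    then have s: "0 < s" using s by simp
    show ?thesis
    proof (rule has_bochner_integral_nn_integral)
      show "AE t in lborel. 0 \<le> indicator {0<..} t * (t powr (- 1 - a / 2) * (1 - exp (- (s * t))))"
        using s by (auto split: split_indicator)
      have "(\<integral>\<^sup>+t. ennreal (indicator {0<..} t * (t powr (- 1 - a / 2) * (1 - exp (- (s * t))))) \<partial>lborel)
        = (\<integral>\<^sup>+t. ennreal (t powr (- 1 - a / 2) * (1 - exp (- (s * t)))) * indicator {0<..} t \<partial>lborel)"
        by (intro nn_integral_cong) (auto split: split_indicator)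
      also have "\<dots> = ennreal (s powr (a / 2)) * J"
        unfolding J_def by (rule nn_integral_powr_scale[where h = "\<lambda>t. 1 - exp (- t)", OF _ s]) measurable
      finally show "(\<integral>\<^sup>+t. ennreal (indicator {0<..} t * (t powr (- 1 - a / 2) * (1 - exp (- (s * t))))) \<partial>lborel) = ennreal (c * s powr (a / 2))"
        using c by (simp add: ennreal_mult'' mult.commute)
    qed (use c in auto)
  qed (simp add: has_bochner_integral_zero)
  with c(1) show ?thesis by blast
qed

lemma nn_integral_heat_time_finite:
  fixes c :: real
  assumes c: "0 < c"
  shows "(\<integral>\<^sup>+t. ennreal (t powr (- 1 - c) * exp (- (1 / (16 * t)))) * indicator {0<..} t \<partial>lborel) < \<infinity>"
proof -
  \<comment> \<open>Flatness of \<open>exp (- 1 / (16 * t))\<close> at \<open>0\<close> of any order \<open>k > c\<close> suffices.\<close>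
  obtain k :: nat where k: "c < real k" using reals_Archimedean2 by blast
  let ?C = "fact k * 16 ^ k :: real"
  have C: "1 \<le> ?C" using mult_mono[of 1 "fact k::real" 1 "16 ^ k"] by (simp add: fact_ge_1)
  have le: "exp (- (1 / (16 * t))) \<le> ?C * min 1 (t powr real k)" if t: "0 < t" for t
  proof -
    have "(1 / (16 * t)) ^ k \<le> fact k * exp (1 / (16 * t))" using t by (intro power_le_fact_exp) auto
    then have "exp (- (1 / (16 * t))) \<le> ?C * t powr real k"
      using t by (simp add: powr_realpow exp_minus field_simps power_mult_distrib power_divide)
    moreover have "exp (- (1 / (16 * t))) \<le> 1" using t by simp
    then have "exp (- (1 / (16 * t))) \<le> ?C" using C by linarith
    ultimately show ?thesis by (simp add: min_def)
  qed
  have "(\<integral>\<^sup>+t. ennreal (t powr (- 1 - c) * exp (- (1 / (16 * t)))) * indicator {0<..} t \<partial>lborel)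
     \<le> (\<integral>\<^sup>+t. ennreal ?C * (ennreal (t powr (- 1 - c) * min 1 (t powr real k)) * indicator {0<..} t) \<partial>lborel)"
  proof (intro nn_integral_mono)
    fix t :: real
    have "t powr (- 1 - c) * exp (- (1 / (16 * t))) \<le> ?C * (t powr (- 1 - c) * min 1 (t powr real k))" if "0 < t"
      using mult_left_mono[OF le[OF that], of "t powr (- 1 - c)"] by (simp add: mult_ac)
    then show "ennreal (t powr (- 1 - c) * exp (- (1 / (16 * t)))) * indicator {0<..} t
      \<le> ennreal ?C * (ennreal (t powr (- 1 - c) * min 1 (t powr real k)) * indicator {0<..} t)"
      by (auto split: split_indicator simp: ennreal_mult'[symmetric] intro!: ennreal_leI)
  qed
  also have "\<dots> = ennreal ?C * (\<integral>\<^sup>+t. ennreal (t powr (- 1 - c) * min 1 (t powr real k)) * indicator {0<..} t \<partial>lborel)"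
    by (rule nn_integral_cmult) measurable
  also have "\<dots> < \<infinity>"
    using nn_integral_powr_min_finite[OF c k] by (simp add: ennreal_mult_less_top)
  finally show ?thesis .
qed

text \<open>
  Writing \<open>norm \<xi> powr a\<close> as a superposition of \<open>1 - exp (- t * norm \<xi> ^ 2)\<close> turns the integral into a
  superposition over \<open>t\<close> of \<open>f - (heat flow of f at time t)\<close>, evaluated at \<open>x\<close>. The first term vanishes by inversion,
  the second is at most \<open>t powr (- n / 2) * exp (- norm x ^ 2 / (16 * t))\<close> up to a constant, and the substitution
  \<open>t = norm x ^ 2 * u\<close> extracts the factor \<open>norm x powr (- (n + a))\<close>.
\<close>
lemma fractional_power_decay:
  fixes f :: "'a::euclidean_space \<Rightarrow> complex"
  assumes f: "bump f" and a: "0 < a" "a < 2"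
  shows "\<exists>C\<ge>0. \<forall>x. 4 \<le> norm x \<longrightarrow>
    norm (LINT \<xi>|lborel. cis (x \<bullet> \<xi>) * (complex_of_real (norm \<xi> powr a) * fourier f \<xi>)) \<le> C * norm x powr (- (real DIM('a) + a))"
proof -
  have [measurable]: "f \<in> borel_measurable borel" using f by (rule bump_measurable)
  have [measurable]: "fourier f \<in> borel_measurable borel" by (rule fourier_measurable) measurable
  let ?n = "real DIM('a)"
  obtain c where c: "0 < c" and sub: "\<And>s. 0 \<le> s \<Longrightarrow> has_bochner_integral lborel
     (\<lambda>t. indicator {0<..} t * (t powr (- 1 - a / 2) * (1 - exp (- (s * t))))) (c * s powr (a / 2))"
    using powr_subordination[OF a] by blast
  define e where "e = (?n + a) / 2"
  have e: "0 < e" using a by (simp add: e_def)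
  define H where "H = (\<integral>\<^sup>+t. ennreal (t powr (- 1 - e) * exp (- (1 / (16 * t)))) * indicator {0<..} t \<partial>lborel)"
  have H: "H = ennreal (enn2real H)" using nn_integral_heat_time_finite[OF e] by (simp add: H_def)
  define M where "M = (LINT y|lborel. norm (f y)) * pi powr (?n / 2)"
  have M: "0 \<le> M" by (simp add: M_def integral_nonneg_AE)
  define C where "C = M * enn2real H / c"
  have "norm (LINT \<xi>|lborel. cis (x \<bullet> \<xi>) * (complex_of_real (norm \<xi> powr a) * fourier f \<xi>)) \<le> C * norm x powr (- (?n + a))"
    if x: "4 \<le> norm x" for x
  proof -
    let ?k = "\<lambda>s t. indicator {0<..} t * (t powr (- 1 - a / 2) * (1 - exp (- (s * t)))) :: real"
    let ?G = "\<lambda>\<xi> t. complex_of_real (?k ((norm \<xi>)\<^sup>2) t) * (cis (x \<bullet> \<xi>) * fourier f \<xi>)"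
    let ?I = "LINT \<xi>|lborel. cis (x \<bullet> \<xi>) * (complex_of_real (norm \<xi> powr a) * fourier f \<xi>)"
    have k0: "0 \<le> ?k s t" if "0 \<le> s" for s t using that by (auto split: split_indicator)
    have sq: "((norm \<xi>)\<^sup>2) powr (a / 2) = norm \<xi> powr a" for \<xi> :: 'a
    proof (cases "\<xi> = 0")
      case False
      then have "(norm \<xi>)\<^sup>2 = norm \<xi> powr 2" by simp
      then show ?thesis by (simp only: powr_powr) simp
    qed simp
    have ki: "integrable lborel (?k ((norm \<xi>)\<^sup>2))" and kI: "(LINT t|lborel. ?k ((norm \<xi>)\<^sup>2) t) = c * norm \<xi> powr a" for \<xi> :: 'a
      using sub[of "(norm \<xi>)\<^sup>2"] by (simp_all only: has_bochner_integral_iff sq zero_le_power2 simp_thms)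
    have int: "integrable (lborel \<Otimes>\<^sub>M lborel) (\<lambda>(\<xi>, t). ?G \<xi> t)"
    proof (rule lborel_pair.Fubini_integrable)
      have "(LINT t|lborel. norm (?G \<xi> t)) = c * (norm \<xi> powr a * norm (fourier f \<xi>))" for \<xi>
      proof -
        have "norm (?G \<xi> t) = ?k ((norm \<xi>)\<^sup>2) t * norm (fourier f \<xi>)" for t
          using k0[of "(norm \<xi>)\<^sup>2" t] by (simp only: norm_mult norm_of_real norm_cis abs_of_nonneg zero_le_power2 mult_1_left)
        then have "(LINT t|lborel. norm (?G \<xi> t)) = (LINT t|lborel. ?k ((norm \<xi>)\<^sup>2) t * norm (fourier f \<xi>))"
          by (simp only:)
        also have "\<dots> = (LINT t|lborel. ?k ((norm \<xi>)\<^sup>2) t) * norm (fourier f \<xi>)"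
          by (rule integral_mult_left_zero)
        finally show ?thesis by (simp only: kI mult.assoc)
      qed
      then show "integrable lborel (\<lambda>\<xi>. LINT t|lborel. norm (case (\<xi>, t) of (\<xi>, t) \<Rightarrow> ?G \<xi> t))"
        using integrable_powr_fourier[OF f, of a] a by simp
      show "AE \<xi> in lborel. integrable lborel (\<lambda>t. case (\<xi>, t) of (\<xi>, t) \<Rightarrow> ?G \<xi> t)"
        using ki by (intro AE_I2) (simp only: prod.case, intro integrable_mult_left integrable_of_real)
    qed measurable
    have "(LINT t|lborel. LINT \<xi>|lborel. ?G \<xi> t) = (LINT \<xi>|lborel. LINT t|lborel. ?G \<xi> t)"
      using lborel_pair.Fubini_integral[OF int] by simp
    also have "\<dots> = (LINT \<xi>|lborel. complex_of_real c * (cis (x \<bullet> \<xi>) * (complex_of_real (norm \<xi> powr a) * fourier f \<xi>)))"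
    proof -
      have "(LINT t|lborel. ?G \<xi> t) = complex_of_real c * (cis (x \<bullet> \<xi>) * (complex_of_real (norm \<xi> powr a) * fourier f \<xi>))" for \<xi>
      proof -
        have "(LINT t|lborel. ?G \<xi> t) = (LINT t|lborel. complex_of_real (?k ((norm \<xi>)\<^sup>2) t)) * (cis (x \<bullet> \<xi>) * fourier f \<xi>)"
          by (rule integral_mult_left_zero)
        also have "(LINT t|lborel. complex_of_real (?k ((norm \<xi>)\<^sup>2) t)) = complex_of_real (c * norm \<xi> powr a)"
          unfolding kI[symmetric] by (rule integral_complex_of_real)
        finally show ?thesis by (simp only: of_real_mult mult_ac)
      qed
      then show ?thesis by (simp only:)
    qed
    also have "\<dots> = complex_of_real c * ?I" by simp
    finally have I: "complex_of_real c * ?I = (LINT t|lborel. LINT \<xi>|lborel. ?G \<xi> t)" by simp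
    have inner: "norm (LINT \<xi>|lborel. ?G \<xi> t) \<le> M * (t powr (- 1 - e) * exp (- ((norm x)\<^sup>2 / (16 * t)))) * indicator {0<..} t" for t
    proof (cases "0 < t")
      case True
      let ?g = "\<lambda>\<xi>. cis (x \<bullet> \<xi>) * (complex_of_real (exp (- (t * (norm \<xi>)\<^sup>2))) * fourier f \<xi>)"
      have i1: "integrable lborel (\<lambda>\<xi>. cis (x \<bullet> \<xi>) * fourier f \<xi>)"
        by (intro integrable_cis_mult fourier_bump_integrable f) measurable
      have i2: "integrable lborel ?g"
        by (rule Bochner_Integration.integrable_bound[OF fourier_bump_integrable[OF f]])
           (use True in \<open>auto simp: norm_mult intro!: mult_left_le_one_le\<close>)
      have "?G \<xi> t = complex_of_real (t powr (- 1 - a / 2)) * (cis (x \<bullet> \<xi>) * fourier f \<xi> - ?g \<xi>)" for \<xi>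
        using True by (simp add: algebra_simps)
      then have "(LINT \<xi>|lborel. ?G \<xi> t) = complex_of_real (t powr (- 1 - a / 2)) * ((LINT \<xi>|lborel. cis (x \<bullet> \<xi>) * fourier f \<xi>) - (LINT \<xi>|lborel. ?g \<xi>))"
        by (simp only: integral_mult_right_zero Bochner_Integration.integral_diff[OF i1 i2])
      also have "norm \<dots> = t powr (- 1 - a / 2) * norm (LINT \<xi>|lborel. ?g \<xi>)"
        by (simp add: fourier_inversion_outside_support[OF f x] norm_mult)
      also have "\<dots> \<le> t powr (- 1 - a / 2) * ((LINT y|lborel. norm (f y)) * ((pi / t) powr (?n / 2) * exp (- ((norm x)\<^sup>2 / (16 * t)))))"
        by (intro mult_left_mono inverse_fourier_heat_bound f True x) auto
      also have "\<dots> = M * ((t powr (- 1 - a / 2) * t powr (- (?n / 2))) * exp (- ((norm x)\<^sup>2 / (16 * t))))"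
        using True by (simp add: M_def powr_divide powr_minus divide_simps)
      also have "t powr (- 1 - a / 2) * t powr (- (?n / 2)) = t powr (- 1 - e)"
      proof -
        have "- 1 - a / 2 + - (?n / 2) = - 1 - e" by (simp add: e_def field_simps)
        then show ?thesis by (simp only: powr_add[symmetric])
      qed
      finally show ?thesis using True by simp
    qed simp
    have "ennreal (c * norm ?I) = ennreal (norm (LINT t|lborel. LINT \<xi>|lborel. ?G \<xi> t))"
      unfolding I[symmetric] norm_mult norm_of_real using c by simp
    also have "\<dots> \<le> (\<integral>\<^sup>+t. ennreal (norm (LINT \<xi>|lborel. ?G \<xi> t)) \<partial>lborel)"
      by (intro integral_norm_bound_ennreal lborel_pair.integrable_snd int)
    also have "\<dots> \<le> (\<integral>\<^sup>+t. ennreal M * (ennreal (t powr (- 1 - e) * exp (- (1 / (16 * ((1 / (norm x)\<^sup>2) * t))))) * indicator {0<..} t) \<partial>lborel)"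
    proof (intro nn_integral_mono)
      fix t
      show "ennreal (norm (LINT \<xi>|lborel. ?G \<xi> t)) \<le> ennreal M * (ennreal (t powr (- 1 - e) * exp (- (1 / (16 * ((1 / (norm x)\<^sup>2) * t))))) * indicator {0<..} t)"
        using ennreal_leI[OF inner[of t]] M by (auto split: split_indicator simp: ennreal_mult'[symmetric])
    qed
    also have "\<dots> = ennreal M * (\<integral>\<^sup>+t. ennreal (t powr (- 1 - e) * exp (- (1 / (16 * ((1 / (norm x)\<^sup>2) * t))))) * indicator {0<..} t \<partial>lborel)"
      by (rule nn_integral_cmult) measurable
    also have "\<dots> = ennreal M * (ennreal ((1 / (norm x)\<^sup>2) powr e) * H)"
    proof -
      have "0 < 1 / (norm x)\<^sup>2" using x by (cases "x = 0") auto
      then show ?thesis unfolding H_def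
        by (subst nn_integral_powr_scale[where h = "\<lambda>t. exp (- (1 / (16 * t)))"]) auto
    qed
    also have "\<dots> = ennreal (M * ((1 / (norm x)\<^sup>2) powr e * enn2real H))"
      using M by (subst H) (simp add: ennreal_mult)
    also have "(1 / (norm x)\<^sup>2) powr e = norm x powr (- (?n + a))"
    proof -
      have "1 / (norm x)\<^sup>2 = norm x powr (- 2)" using x by (subst powr_minus) (auto simp: divide_inverse)
      moreover have "- 2 * e = - (?n + a)" by (simp add: e_def)
      ultimately show ?thesis by (simp only: powr_powr)
    qed
    finally have "c * norm ?I \<le> M * (norm x powr (- (?n + a)) * enn2real H)"
      using M by (simp add: zero_le_mult_iff)
    then show ?thesis using c by (simp add: C_def field_simps)
  qed
  moreover have "0 \<le> C" using M c by (simp add: C_def)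
  ultimately show ?thesis by blast
qed

text \<open>
  With \<open>\<alpha> = 2 * m + a\<close> and \<open>0 \<le> a < 2\<close>, the even part \<open>norm \<xi> ^ (2 * m)\<close> is absorbed by applying a power of
  the Laplacian to \<open>f\<close>, which gives a bump again. For \<open>a = 0\<close> the result is supported near the origin. What
  matters later is only that the exponent \<open>\<beta>\<close> exceeds the dimension.
\<close>
lemma frac_laplacian_bump_decay:
  fixes f :: "'a::euclidean_space \<Rightarrow> complex"
  assumes f: "bump f" and \<alpha>: "0 < \<alpha>"
  shows "\<exists>\<beta>>real DIM('a). \<exists>C\<ge>0. \<forall>x. norm (frac_laplacian (\<alpha> / 2) f x) \<le> C * (1 + norm x) powr (- \<beta>)"
proof -
  have [measurable]: "f \<in> borel_measurable borel" using f by (rule bump_measurable)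
  let ?n = "real DIM('a)"
  define m where "m = nat \<lfloor>\<alpha> / 2\<rfloor>"
  define a where "a = \<alpha> - 2 * real m"
  have "real m = of_int \<lfloor>\<alpha> / 2\<rfloor>" using \<alpha> by (simp add: m_def)
  then have a: "0 \<le> a" "a < 2" unfolding a_def by linarith+
  obtain g where g: "bump g" "\<And>\<xi>. fourier g \<xi> = of_real (norm \<xi> ^ (2 * m)) * fourier f \<xi>"
    using fourier_laplacian_power[OF f] by blast
  have [measurable]: "g \<in> borel_measurable borel" using g(1) by (rule bump_measurable)
  define k where "k = 1 / (2 * pi) ^ DIM('a)"
  have k: "0 < k" by (simp add: k_def)
  let ?I = "\<lambda>x. LINT \<xi>|lborel. cis (x \<bullet> \<xi>) * (complex_of_real (norm \<xi> powr a) * fourier g \<xi>)"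
  have fl: "frac_laplacian (\<alpha> / 2) f x = complex_of_real k * ?I x" for x
  proof -
    have "frac_laplacian (\<alpha> / 2) f x = complex_of_real k * (LINT \<xi>|lborel. cis (x \<bullet> \<xi>) * (complex_of_real (norm \<xi> powr \<alpha>) * fourier f \<xi>))"
    proof -
      have "(\<lambda>\<xi>. cis (x \<bullet> \<xi>) * (complex_of_real (norm \<xi> powr \<alpha>) * fourier f \<xi>)) \<in> borel_measurable lborel"
        by measurable
      from integral_completion[OF this] show ?thesis
        by (simp add: frac_laplacian_def fourier_multiplier_def inverse_fourier_def k_def)
    qed
    also have "(LINT \<xi>|lborel. cis (x \<bullet> \<xi>) * (complex_of_real (norm \<xi> powr \<alpha>) * fourier f \<xi>)) = ?I x"
    proof (rule integral_cong_AE)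
      show "AE \<xi> in lborel. cis (x \<bullet> \<xi>) * (complex_of_real (norm \<xi> powr \<alpha>) * fourier f \<xi>) = cis (x \<bullet> \<xi>) * (complex_of_real (norm \<xi> powr a) * fourier g \<xi>)"
        using AE_lborel_singleton[of 0]
      proof eventually_elim
        case (elim \<xi>)
        then have "norm \<xi> powr \<alpha> = norm \<xi> powr a * norm \<xi> ^ (2 * m)"
          by (simp add: powr_realpow[symmetric] powr_add[symmetric] a_def)
        then show ?case by (simp add: g(2))
      qed
    qed measurable
    finally show ?thesis .
  qed
  have far: "\<exists>\<beta>>?n. \<exists>C\<ge>0. \<forall>x. 4 \<le> norm x \<longrightarrow> norm (?I x) \<le> C * norm x powr (- \<beta>)"
  proof (cases "a = 0")
    case True
    have "?I x = 0" if "4 \<le> norm x" for x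
    proof -
      have "?I x = (LINT \<xi>|lborel. cis (x \<bullet> \<xi>) * fourier g \<xi>)"
      proof (rule integral_cong_AE)
        show "AE \<xi> in lborel. cis (x \<bullet> \<xi>) * (complex_of_real (norm \<xi> powr a) * fourier g \<xi>) = cis (x \<bullet> \<xi>) * fourier g \<xi>"
          using AE_lborel_singleton[of 0] by eventually_elim (simp add: True)
      qed measurable
      then show ?thesis using fourier_inversion_outside_support[OF g(1) that] by simp
    qed
    then show ?thesis by (intro exI[of _ "?n + 1"] conjI exI[of _ 0]) auto
  next
    case False
    then have "0 < a" using a by simp
    then have "?n < ?n + a" by simp
    with fractional_power_decay[OF g(1) \<open>0 < a\<close> a(2)] show ?thesis by blast
  qed
  then obtain \<beta> C where \<beta>: "?n < \<beta>" and C: "0 \<le> C" "\<And>x. 4 \<le> norm x \<Longrightarrow> norm (?I x) \<le> C * norm x powr (- \<beta>)"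
    by blast
  define B where "B = (LINT \<xi>|lborel. norm \<xi> powr a * norm (fourier g \<xi>))"
  have B: "norm (?I x) \<le> B" for x
  proof -
    have "norm (?I x) \<le> (LINT \<xi>|lborel. norm (cis (x \<bullet> \<xi>) * (complex_of_real (norm \<xi> powr a) * fourier g \<xi>)))"
      by (rule integral_norm_bound)
    then show ?thesis by (simp add: B_def norm_mult)
  qed
  have B0: "0 \<le> B" by (simp add: B_def integral_nonneg_AE)
  have b0: "0 < \<beta>" using \<beta> by (meson le_less_trans of_nat_0_le_iff)
  \<comment> \<open>Far out, \<open>norm x \<ge> (1 + norm x) / 2\<close>; in the ball of radius \<open>4\<close>, \<open>1 + norm x \<le> 5\<close> and boundedness suffices.\<close>
  let ?E = "C * 2 powr \<beta> + B * 5 powr \<beta>"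
  have "norm (?I x) \<le> ?E * (1 + norm x) powr (- \<beta>)" for x
  proof (cases "4 \<le> norm x")
    case True
    have "norm x powr (- \<beta>) \<le> ((1 + norm x) / 2) powr (- \<beta>)"
      using True b0 by (intro powr_mono2') auto
    also have "\<dots> = 2 powr \<beta> * (1 + norm x) powr (- \<beta>)"
      by (simp add: powr_divide powr_minus divide_simps)
    finally have "C * norm x powr (- \<beta>) \<le> C * (2 powr \<beta> * (1 + norm x) powr (- \<beta>))"
      using C(1) by (intro mult_left_mono)
    also have "\<dots> \<le> ?E * (1 + norm x) powr (- \<beta>)"
      using B0 by (simp add: algebra_simps)
    finally show ?thesis using C(2)[OF True] by simp
  next
    case False
    have "1 = 5 powr \<beta> * 5 powr (- \<beta>)" by (simp add: powr_minus)
    also have "\<dots> \<le> 5 powr \<beta> * (1 + norm x) powr (- \<beta>)"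
      using False b0 by (intro mult_left_mono powr_mono2') (auto simp: add_pos_nonneg)
    finally have "B * 1 \<le> B * (5 powr \<beta> * (1 + norm x) powr (- \<beta>))"
      using B0 by (intro mult_left_mono)
    also have "\<dots> \<le> ?E * (1 + norm x) powr (- \<beta>)"
      using C(1) by (simp add: algebra_simps)
    finally show ?thesis using B[of x] by simp
  qed
  then have "norm (frac_laplacian (\<alpha> / 2) f x) \<le> (k * ?E) * (1 + norm x) powr (- \<beta>)" for x
    using k by (simp add: fl norm_mult mult.assoc)
  moreover have "0 \<le> k * ?E" using k C(1) B0 by simp
  ultimately show ?thesis using \<beta> by blast
qed

lemma lborel_integral_affine:
  fixes f :: "'a::euclidean_space \<Rightarrow> complex"
  assumes [measurable]: "f \<in> borel_measurable borel" and c: "0 < c"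
  shows "(LINT x|lborel. f x) = c ^ DIM('a) *\<^sub>R (LINT x|lborel. f (t + c *\<^sub>R x))"
proof -
  have "(LINT x|lborel. f x) = (LINT x|density (distr lborel borel (\<lambda>x. t + c *\<^sub>R x)) (\<lambda>_. \<bar>c\<bar> ^ DIM('a)). f x)"
    using c by (subst lborel_affine[of c t]) auto
  also have "\<dots> = (LINT x|distr lborel borel (\<lambda>x. t + c *\<^sub>R x). (\<bar>c\<bar> ^ DIM('a)) *\<^sub>R f x)"
    by (subst integral_density[symmetric]) (auto simp: ennreal_power)
  also have "\<dots> = (LINT x|lborel. (\<bar>c\<bar> ^ DIM('a)) *\<^sub>R f (t + c *\<^sub>R x))"
    by (subst integral_distr) auto
  finally show ?thesis using c by simp
qed

lemma fourier_affine:
  fixes f :: "'a::euclidean_space \<Rightarrow> complex"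
  assumes [measurable]: "f \<in> borel_measurable borel" and r: "0 < r"
  shows "fourier (\<lambda>x. f (r *\<^sub>R (x - x0))) \<xi> = cis (- (x0 \<bullet> \<xi>)) * fourier f ((1 / r) *\<^sub>R \<xi>) / of_real (r ^ DIM('a))"
proof -
  have "fourier (\<lambda>x. f (r *\<^sub>R (x - x0))) \<xi> = (LINT x|lborel. cis (- (x \<bullet> \<xi>)) * f (r *\<^sub>R (x - x0)))"
    by (rule fourier_lborel) measurable
  also have "\<dots> = (1 / r) ^ DIM('a) *\<^sub>R (LINT y|lborel. cis (- ((x0 + (1 / r) *\<^sub>R y) \<bullet> \<xi>)) * f (r *\<^sub>R ((x0 + (1 / r) *\<^sub>R y) - x0)))"
    using r by (intro lborel_integral_affine) auto
  also have "(LINT y|lborel. cis (- ((x0 + (1 / r) *\<^sub>R y) \<bullet> \<xi>)) * f (r *\<^sub>R ((x0 + (1 / r) *\<^sub>R y) - x0)))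
     = (LINT y|lborel. cis (- (x0 \<bullet> \<xi>)) * (cis (- (y \<bullet> ((1 / r) *\<^sub>R \<xi>))) * f y))"
    using r by (simp add: inner_add_left cis_mult mult.assoc[symmetric] add.commute)
  also have "\<dots> = cis (- (x0 \<bullet> \<xi>)) * fourier f ((1 / r) *\<^sub>R \<xi>)"
    by (simp only: integral_mult_right_zero fourier_lborel[OF assms(1)])
  finally show ?thesis using r by (simp add: scaleR_conv_of_real power_divide)
qed

text \<open>
  The multiplier \<open>norm \<xi> powr (2 * s)\<close> is homogeneous of degree \<open>2 * s\<close>.
\<close>
lemma frac_laplacian_affine:
  fixes f :: "'a::euclidean_space \<Rightarrow> complex"
  assumes [measurable]: "f \<in> borel_measurable borel" and r: "0 < r"
  shows "frac_laplacian s (\<lambda>x. f (r *\<^sub>R (x - x0))) x = of_real (r powr (2 * s)) * frac_laplacian s f (r *\<^sub>R (x - x0))"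
proof -
  have [measurable]: "fourier (\<lambda>x. f (r *\<^sub>R (x - x0))) \<in> borel_measurable borel" by measurable
  let ?F = "\<lambda>\<xi>. cis (x \<bullet> \<xi>) * (complex_of_real (norm \<xi> powr (2 * s)) * fourier (\<lambda>x. f (r *\<^sub>R (x - x0))) \<xi>)"
  let ?G = "\<lambda>\<xi>. cis ((r *\<^sub>R (x - x0)) \<bullet> \<xi>) * (complex_of_real (norm \<xi> powr (2 * s)) * fourier f \<xi>)"
  have FG: "?F (0 + r *\<^sub>R \<xi>) = of_real (r powr (2 * s) / r ^ DIM('a)) * ?G \<xi>" for \<xi>
  proof -
    define u where "u = cis ((r *\<^sub>R (x - x0)) \<bullet> \<xi>)"
    have u: "u = cis (r * (x \<bullet> \<xi>)) * cis (- (r * (x0 \<bullet> \<xi>)))"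
      by (simp add: u_def cis_mult inner_diff_left algebra_simps)
    show ?thesis
      unfolding fourier_affine[OF assms] u_def[symmetric] u
      using r by (simp add: powr_mult)
  qed
  have "integral\<^sup>L lborel ?F = r ^ DIM('a) *\<^sub>R (LINT \<xi>|lborel. ?F (0 + r *\<^sub>R \<xi>))"
    by (rule lborel_integral_affine[OF _ r]) measurable
  also have "\<dots> = of_real (r powr (2 * s)) * integral\<^sup>L lborel ?G"
    unfolding FG integral_mult_right_zero using r by (simp add: scaleR_conv_of_real)
  finally have "integral\<^sup>L lborel ?F = of_real (r powr (2 * s)) * integral\<^sup>L lborel ?G" .
  moreover have "integral\<^sup>L lebesgue ?F = integral\<^sup>L lborel ?F" "integral\<^sup>L lebesgue ?G = integral\<^sup>L lborel ?G"
    by (rule integral_completion; measurable)+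
  ultimately show ?thesis
    by (simp add: frac_laplacian_def fourier_multiplier_def inverse_fourier_def)
qed

section \<open>Testing the inequality on bump functions\<close>

lemma weighted_tail_integral_le:
  fixes \<sigma> :: "'a::euclidean_space \<Rightarrow> real"
  assumes n: "real n < s" and \<delta>: "0 < \<delta>" and B: "0 \<le> B"
    and bd: "\<And>t. \<delta> \<le> t \<Longrightarrow> weighted_measure \<sigma> (ball x t) \<le> ennreal (B * t ^ n)"
  shows "(\<integral>\<^sup>+t\<in>{\<delta><..}. weighted_measure \<sigma> (ball x t) / ennreal (t powr (s + 1)) \<partial>lborel)
    \<le> ennreal (B / (s - n) * \<delta> powr (real n - s))"
proof -
  have "(\<integral>\<^sup>+t\<in>{\<delta><..}. weighted_measure \<sigma> (ball x t) / ennreal (t powr (s + 1)) \<partial>lborel)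
     \<le> (\<integral>\<^sup>+t. ennreal B * ennreal (indicator {\<delta>..} t * t powr (real n - s - 1)) \<partial>lborel)"
  proof (intro nn_integral_mono)
    fix t :: real
    have "weighted_measure \<sigma> (ball x t) / ennreal (t powr (s + 1)) \<le> ennreal (B * t powr (real n - s - 1))" if t: "\<delta> < t"
    proof -
      have t0: "0 < t" using \<delta> t by simp
      have "weighted_measure \<sigma> (ball x t) / ennreal (t powr (s + 1)) \<le> ennreal (B * t ^ n) / ennreal (t powr (s + 1))"
        using t by (intro divide_right_mono_ennreal bd) simp
      also have "\<dots> = ennreal (B * t ^ n / t powr (s + 1))"
        using t0 B by (intro divide_ennreal) auto
      also have "B * t ^ n / t powr (s + 1) = B * t powr (real n - s - 1)"
        using t0 by (simp add: powr_realpow[symmetric] powr_diff powr_add field_simps)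
      finally show ?thesis .
    qed
    then show "weighted_measure \<sigma> (ball x t) / ennreal (t powr (s + 1)) * indicator {\<delta><..} t
      \<le> ennreal B * ennreal (indicator {\<delta>..} t * t powr (real n - s - 1))"
      using B by (auto split: split_indicator simp: ennreal_mult'[symmetric])
  qed
  also have "\<dots> = ennreal B * (\<integral>\<^sup>+t. ennreal (indicator {\<delta>..} t * t powr (real n - s - 1)) \<partial>lborel)"
    by (rule nn_integral_cmult) measurable
  also have "(\<integral>\<^sup>+t. ennreal (indicator {\<delta>..} t * t powr (real n - s - 1)) \<partial>lborel)
     = ennreal (- (\<delta> powr (real n - s - 1 + 1)) / (real n - s - 1 + 1))"
    using n \<delta> by (intro nn_integral_has_integral_lebesgue has_integral_powr_to_inf) auto
  also have "- (\<delta> powr (real n - s - 1 + 1)) / (real n - s - 1 + 1) = \<delta> powr (real n - s) / (s - real n)"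
    using n by (simp add: field_simps)
  also have "ennreal B * ennreal (\<delta> powr (real n - s) / (s - real n)) = ennreal (B / (s - n) * \<delta> powr (real n - s))"
    using n B by (simp add: ennreal_mult'[symmetric])
  finally show ?thesis .
qed

lemma ennreal_powr_le:
  assumes "T \<le> ennreal \<tau>" "0 \<le> \<tau>" "0 \<le> a"
  shows "ennreal_powr T a \<le> ennreal (\<tau> powr a)"
proof -
  have "T \<noteq> \<infinity>" using assms(1) by (auto simp: top_unique)
  moreover have "enn2real T \<le> \<tau>" using assms by (intro enn2real_leI)
  ultimately show ?thesis
    using assms(3) by (auto simp: ennreal_powr_def intro!: ennreal_leI powr_mono2)
qed

text \<open>
  The factor \<open>exp 1\<close> compensates \<open>exp (- 1 / (4 - norm x ^ 2)) \<ge> exp (- 1 / 3)\<close> on the unit ball.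
\<close>
definition test_bump :: "'a::euclidean_space \<Rightarrow> complex" where
  "test_bump x = complex_of_real (exp 1) * complex_of_real (flat_exp 0 (4 - x \<bullet> x))"

lemma bump_test_bump: "bump test_bump"
  using bump_cmult[OF bump_radial, of "complex_of_real (exp 1)" 0] by (simp add: test_bump_def[abs_def])

lemma norm_test_bump_le: "norm (test_bump x) \<le> exp 1"
  by (simp add: test_bump_def norm_mult flat_exp_def)

lemma one_le_norm_test_bump: "norm x \<le> 1 \<Longrightarrow> 1 \<le> norm (test_bump x)"
proof -
  assume "norm x \<le> 1"
  then have "(norm x)\<^sup>2 \<le> 1\<^sup>2" by (intro power_mono) auto
  then have x: "3 \<le> 4 - x \<bullet> x" by (simp add: dot_square_norm)
  then have "1 / (4 - x \<bullet> x) \<le> 1" by simp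
  then have "exp 0 \<le> exp (1 + - (1 / (4 - x \<bullet> x)))" by (subst exp_le_cancel_iff) linarith
  then have "1 \<le> exp 1 * exp (- (1 / (4 - x \<bullet> x)))" by (simp only: exp_add exp_zero)
  then show ?thesis using x by (simp add: test_bump_def norm_mult flat_exp_def)
qed

lemma Lp_norm_pow_test_bump_le:
  fixes w :: "'a::euclidean_space \<Rightarrow> real"
  assumes p: "0 < p" and \<delta>: "0 < \<delta>" and w: "weight w"
  shows "Lp_norm_pow p w (\<lambda>x. test_bump ((1 / \<delta>) *\<^sub>R (x - x0))) \<le> ennreal (exp 1 powr p) * weighted_measure w (ball x0 (2 * \<delta>))"
proof -
  have [measurable]: "w \<in> borel_measurable lebesgue" and pos: "AE x in lebesgue. 0 < w x" using w by (auto simp: weight_def)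
  have [measurable]: "ball x0 (2 * \<delta>) \<in> sets lebesgue" by simp
  have "Lp_norm_pow p w (\<lambda>x. test_bump ((1 / \<delta>) *\<^sub>R (x - x0)))
     \<le> (\<integral>\<^sup>+x. ennreal (exp 1 powr p) * (ennreal (w x) * indicator (ball x0 (2 * \<delta>)) x) \<partial>lebesgue)"
    unfolding Lp_norm_pow_def
  proof (intro nn_integral_mono_AE)
    show "AE x in lebesgue. ennreal (norm (test_bump ((1 / \<delta>) *\<^sub>R (x - x0))) powr p * w x)
       \<le> ennreal (exp 1 powr p) * (ennreal (w x) * indicator (ball x0 (2 * \<delta>)) x)"
      using pos
    proof eventually_elim
      case (elim x)
      show ?case
      proof (cases "x \<in> ball x0 (2 * \<delta>)")
        case True
        have "norm (test_bump ((1 / \<delta>) *\<^sub>R (x - x0))) powr p \<le> exp 1 powr p"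
          using p by (intro powr_mono2 norm_test_bump_le) auto
        then show ?thesis
          using True elim by (simp add: ennreal_mult''[symmetric] ennreal_leI mult_right_mono)
      next
        case False
        then have "2 \<le> norm ((1 / \<delta>) *\<^sub>R (x - x0))"
          using \<delta> by (simp add: dist_norm norm_minus_commute pos_le_divide_eq del: scaleR_diff_right)
        from bump_support[OF bump_test_bump this] show ?thesis by simp
      qed
    qed
  qed
  also have "\<dots> = ennreal (exp 1 powr p) * weighted_measure w (ball x0 (2 * \<delta>))"
    unfolding weighted_measure_def by (intro nn_integral_cmult) measurable
  finally show ?thesis .
qed

lemma weighted_measure_ball_le_test_bump:
  fixes w V :: "'a::euclidean_space \<Rightarrow> real"
  assumes p: "0 < p" and \<delta>: "0 < \<delta>"
  shows "weighted_measure (\<lambda>x. \<bar>V x\<bar> powr p * w x) (ball x0 \<delta>)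
    \<le> Lp_norm_pow p w (\<lambda>x. complex_of_real (V x) * test_bump ((1 / \<delta>) *\<^sub>R (x - x0)))"
  unfolding weighted_measure_def Lp_norm_pow_def
proof (intro nn_integral_mono)
  fix x
  show "ennreal (\<bar>V x\<bar> powr p * w x) * indicator (ball x0 \<delta>) x
    \<le> ennreal (norm (complex_of_real (V x) * test_bump ((1 / \<delta>) *\<^sub>R (x - x0))) powr p * w x)"
  proof (cases "x \<in> ball x0 \<delta> \<and> 0 \<le> w x")
    case True
    then have "norm ((1 / \<delta>) *\<^sub>R (x - x0)) \<le> 1"
      using \<delta> by (simp add: dist_norm norm_minus_commute del: scaleR_diff_right)
    from one_le_norm_test_bump[OF this]
    have "\<bar>V x\<bar> * 1 \<le> norm (complex_of_real (V x) * test_bump ((1 / \<delta>) *\<^sub>R (x - x0)))"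
      unfolding norm_mult norm_of_real by (intro mult_left_mono) auto
    then have "\<bar>V x\<bar> powr p \<le> norm (complex_of_real (V x) * test_bump ((1 / \<delta>) *\<^sub>R (x - x0))) powr p"
      using p by (intro powr_mono2) auto
    then show ?thesis using True by (auto intro!: ennreal_leI mult_right_mono)
  next
    case False
    then show ?thesis by (auto split: split_indicator simp: ennreal_neg mult_nonneg_nonpos)
  qed
qed

text \<open>
  The fractional Laplacian of a bump at scale \<open>\<delta>\<close> has size \<open>\<delta> powr (- \<alpha>)\<close> and decays with exponent
  \<open>\<beta> > n\<close> at that scale. Its \<open>p\<close>-th power therefore decays with exponent \<open>\<beta> * p\<close>, which beats the growth
  \<open>t powr (n * p)\<close> of the \<open>w\<close>-measure of balls.
\<close>
lemma Lp_norm_pow_frac_laplacian_test_bump_le: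
  fixes p \<alpha> :: real
  assumes p: "1 < p" and \<alpha>: "0 < \<alpha>"
  shows "\<exists>C>0. \<forall>(w::'a::euclidean_space \<Rightarrow> real) x0 \<delta> A. weight w \<longrightarrow> 0 < \<delta> \<longrightarrow> 0 \<le> A \<longrightarrow>
     (\<forall>t\<ge>\<delta>. weighted_measure w (ball x0 t) \<le> ennreal (A * t powr (real DIM('a) * p))) \<longrightarrow>
     Lp_norm_pow p w (frac_laplacian (\<alpha> / 2) (\<lambda>x. test_bump ((1 / \<delta>) *\<^sub>R (x - x0))))
       \<le> ennreal (C * A * \<delta> powr (real DIM('a) * p - \<alpha> * p))"
proof -
  let ?n = "real DIM('a)" and ?\<eta> = "test_bump :: 'a \<Rightarrow> complex"
  obtain \<beta> L where \<beta>: "?n < \<beta>" and L: "0 \<le> L" "\<And>x. norm (frac_laplacian (\<alpha> / 2) ?\<eta> x) \<le> L * (1 + norm x) powr (- \<beta>)"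
    using frac_laplacian_bump_decay[OF bump_test_bump \<alpha>, where 'a='a] by blast
  have "?n * p < \<beta> * p" "0 \<le> ?n * p" using \<beta> p by auto
  from dyadic_tail_bound[OF this, where 'a='a]
  obtain C where C: "0 < C" and dy: "\<forall>(w::'a \<Rightarrow> real) x0 s A. w \<in> borel_measurable lebesgue \<longrightarrow> 0 < s \<longrightarrow> 0 \<le> A \<longrightarrow>
     (\<forall>t\<ge>s. weighted_measure w (ball x0 t) \<le> ennreal (A * t powr (?n * p))) \<longrightarrow>
     (\<integral>\<^sup>+x. ennreal ((1 + norm (x - x0) / s) powr (- (\<beta> * p)) * w x) \<partial>lebesgue) \<le> ennreal (C * A * s powr (?n * p))"
    by blast
  define E where "E = (L + 1) powr p * C"
  have "Lp_norm_pow p w (frac_laplacian (\<alpha> / 2) (\<lambda>x. ?\<eta> ((1 / \<delta>) *\<^sub>R (x - x0)))) \<le> ennreal (E * A * \<delta> powr (?n * p - \<alpha> * p))"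
    if w: "weight w" and \<delta>: "0 < \<delta>" and A: "0 \<le> A" and bd: "\<forall>t\<ge>\<delta>. weighted_measure w (ball x0 t) \<le> ennreal (A * t powr (?n * p))"
    for w :: "'a \<Rightarrow> real" and x0 \<delta> A
  proof -
    have [measurable]: "w \<in> borel_measurable lebesgue" and pos: "AE x in lebesgue. 0 < w x" using w by (auto simp: weight_def)
    have [measurable]: "(\<lambda>x. (1 + norm (x - x0) / \<delta>) powr (- (\<beta> * p))) \<in> borel_measurable lebesgue"
      by (rule measurable_completion) measurable
    let ?c = "(L + 1) powr p * \<delta> powr (- (\<alpha> * p))"
    have [measurable]: "?\<eta> \<in> borel_measurable borel" by (rule bump_measurable[OF bump_test_bump])
    have pw: "norm (frac_laplacian (\<alpha> / 2) (\<lambda>x. ?\<eta> ((1 / \<delta>) *\<^sub>R (x - x0))) x) powr p \<le> ?c * (1 + norm (x - x0) / \<delta>) powr (- (\<beta> * p))" for x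
    proof -
      have "norm (frac_laplacian (\<alpha> / 2) (\<lambda>x. ?\<eta> ((1 / \<delta>) *\<^sub>R (x - x0))) x) = \<delta> powr (- \<alpha>) * norm (frac_laplacian (\<alpha> / 2) ?\<eta> ((1 / \<delta>) *\<^sub>R (x - x0)))"
      proof -
        have "(1 / \<delta>) powr (2 * (\<alpha> / 2)) = \<delta> powr (- \<alpha>)" using \<delta> by (simp add: powr_divide powr_minus_divide)
        moreover have "0 < 1 / \<delta>" using \<delta> by simp
        ultimately show ?thesis
          by (simp only: frac_laplacian_affine bump_measurable[OF bump_test_bump] norm_mult norm_of_real abs_of_nonneg powr_ge_zero)
      qed
      also have "\<dots> \<le> \<delta> powr (- \<alpha>) * ((L + 1) * (1 + norm (x - x0) / \<delta>) powr (- \<beta>))"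
      proof (intro mult_left_mono)
        have "norm ((1 / \<delta>) *\<^sub>R (x - x0)) = norm (x - x0) / \<delta>" using \<delta> by (simp del: scaleR_diff_right)
        then have "norm (frac_laplacian (\<alpha> / 2) ?\<eta> ((1 / \<delta>) *\<^sub>R (x - x0))) \<le> L * (1 + norm (x - x0) / \<delta>) powr (- \<beta>)"
          using L(2)[of "(1 / \<delta>) *\<^sub>R (x - x0)"] by (simp only:)
        also have "\<dots> \<le> (L + 1) * (1 + norm (x - x0) / \<delta>) powr (- \<beta>)" by (intro mult_right_mono) auto
        finally show "norm (frac_laplacian (\<alpha> / 2) ?\<eta> ((1 / \<delta>) *\<^sub>R (x - x0))) \<le> (L + 1) * (1 + norm (x - x0) / \<delta>) powr (- \<beta>)" .
      qed simp
      finally have "norm (frac_laplacian (\<alpha> / 2) (\<lambda>x. ?\<eta> ((1 / \<delta>) *\<^sub>R (x - x0))) x) powr p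
        \<le> (\<delta> powr (- \<alpha>) * ((L + 1) * (1 + norm (x - x0) / \<delta>) powr (- \<beta>))) powr p"
        using p by (intro powr_mono2) auto
      also have "\<dots> = ?c * (1 + norm (x - x0) / \<delta>) powr (- (\<beta> * p))"
        using L(1) by (simp add: powr_mult powr_powr)
      finally show ?thesis .
    qed
    have "Lp_norm_pow p w (frac_laplacian (\<alpha> / 2) (\<lambda>x. ?\<eta> ((1 / \<delta>) *\<^sub>R (x - x0))))
      \<le> (\<integral>\<^sup>+x. ennreal ?c * ennreal ((1 + norm (x - x0) / \<delta>) powr (- (\<beta> * p)) * w x) \<partial>lebesgue)"
      unfolding Lp_norm_pow_def
    proof (intro nn_integral_mono_AE)
      show "AE x in lebesgue. ennreal (norm (frac_laplacian (\<alpha> / 2) (\<lambda>x. ?\<eta> ((1 / \<delta>) *\<^sub>R (x - x0))) x) powr p * w x)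
        \<le> ennreal ?c * ennreal ((1 + norm (x - x0) / \<delta>) powr (- (\<beta> * p)) * w x)"
        using pos
      proof eventually_elim
        case (elim x)
        have "norm (frac_laplacian (\<alpha> / 2) (\<lambda>x. ?\<eta> ((1 / \<delta>) *\<^sub>R (x - x0))) x) powr p * w x
           \<le> ?c * (1 + norm (x - x0) / \<delta>) powr (- (\<beta> * p)) * w x"
          using pw elim by (intro mult_right_mono) auto
        then show ?case by (simp add: ennreal_mult'[symmetric] mult.assoc ennreal_leI del: scaleR_diff_right)
      qed
    qed
    also have "\<dots> = ennreal ?c * (\<integral>\<^sup>+x. ennreal ((1 + norm (x - x0) / \<delta>) powr (- (\<beta> * p)) * w x) \<partial>lebesgue)"
      by (intro nn_integral_cmult) measurable
    also have "\<dots> \<le> ennreal ?c * ennreal (C * A * \<delta> powr (?n * p))"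
      using dy \<delta> A bd by (intro mult_left_mono) auto
    also have "\<dots> = ennreal (E * A * \<delta> powr (?n * p - \<alpha> * p))"
    proof -
      have "\<delta> powr (?n * p - \<alpha> * p) = \<delta> powr (- (\<alpha> * p)) * \<delta> powr (?n * p)"
        by (simp add: powr_add[symmetric])
      then have "?c * (C * A * \<delta> powr (?n * p)) = E * A * \<delta> powr (?n * p - \<alpha> * p)" by (simp add: E_def)
      then show ?thesis by (metis ennreal_mult' powr_ge_zero mult_nonneg_nonneg)
    qed
    finally show ?thesis .
  qed
  moreover have "0 < E" using L(1) C by (simp add: E_def)
  ultimately show ?thesis by blast
qed

theorem corollary1p2:
  fixes p p' \<alpha> :: real
    and w \<sigma> V :: "'a::euclidean_space \<Rightarrow> real"
    and \<mu>w :: "'a set \<Rightarrow> ennreal"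
  assumes "1 < p"
    and "p' = p / (p - 1)"
    and "0 < \<alpha>" and "\<alpha> < real DIM('a) / p"
    and "weight w"
    and "\<sigma> = (\<lambda>x. w x powr (1 - p'))"
    and "\<sigma> \<in> A1"
    and "AE x in lebesgue. 0 \<le> V x"
    and "V \<in> Lp_loc p (\<lambda>_. 1) \<inter> Lp_loc p w \<inter> Lp_loc p \<sigma>"
    and "\<forall>\<epsilon>>0. \<exists>C>0. \<forall>\<phi>\<in>Cc_infinity.
           Lp_norm_pow p w (\<lambda>x. complex_of_real (V x) * \<phi> x)
             \<le> ennreal \<epsilon> * Lp_norm_pow p w (frac_laplacian (\<alpha> / 2) \<phi>)
               + ennreal C * Lp_norm_pow p w \<phi>"
    and "\<mu>w = weighted_measure (\<lambda>x. \<bar>V x\<bar> powr p * w x)"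
  shows "((\<lambda>\<delta>. SUP x\<^sub>0. \<mu>w (ball x\<^sub>0 \<delta>) *
            ennreal_powr
              (\<integral>\<^sup>+t\<in>{\<delta><..}. weighted_measure \<sigma> (ball x\<^sub>0 t)
                 / ennreal (t powr ((real DIM('a) - \<alpha>) * p' + 1)) \<partial>lborel)
              (p - 1)) \<longlongrightarrow> 0) (at_right 0)"
proof -
  let ?n = "real DIM('a)"
  let ?T = "\<lambda>x0 \<delta>. \<integral>\<^sup>+t\<in>{\<delta><..}. weighted_measure \<sigma> (ball x0 t) / ennreal (t powr ((?n - \<alpha>) * p' + 1)) \<partial>lborel"
  let ?\<phi> = "\<lambda>x0 \<delta> x. test_bump ((1 / \<delta>) *\<^sub>R (x - x0)) :: complex"
  note p = \<open>1 < p\<close>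
  define s where "s = (?n - \<alpha>) * p'"
  have sp: "s * (p - 1) = (?n - \<alpha>) * p" using p by (simp add: s_def assms(2))
  \<comment> \<open>By \<open>\<alpha> < n / p\<close> the exponent \<open>s\<close> exceeds the growth rate \<open>n\<close> of the \<open>\<sigma>\<close>-measure of balls.\<close>
  have "?n * (p - 1) < s * (p - 1)"
    unfolding sp using assms(4) p by (simp add: pos_less_divide_eq algebra_simps)
  then have sn: "?n < s" using p by simp
  obtain K S where K: "0 < K" and S0: "\<And>x t. 0 < t \<Longrightarrow> 0 < S x t"
    and S\<sigma>: "\<And>x t. 0 < t \<Longrightarrow> weighted_measure \<sigma> (ball x t) \<le> ennreal (S x t)"
    and Sdbl: "\<And>x s t. 0 < s \<Longrightarrow> s \<le> t \<Longrightarrow> S x t \<le> K * (t / s) ^ DIM('a) * S x s"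
    and Sw: "\<And>x s t. 0 < s \<Longrightarrow> s \<le> t \<Longrightarrow>
       weighted_measure w (ball x t) \<le> ennreal (K * t powr (?n * p) * S x s powr (1 - p))"
    using A1_dual_weight_bounds[OF assms(1,2,5,6,7)] by blast
  obtain c\<^sub>1 where c1: "0 < c\<^sub>1" and lap: "\<forall>(w::'a \<Rightarrow> real) x0 \<delta> A. weight w \<longrightarrow> 0 < \<delta> \<longrightarrow> 0 \<le> A \<longrightarrow>
     (\<forall>t\<ge>\<delta>. weighted_measure w (ball x0 t) \<le> ennreal (A * t powr (?n * p))) \<longrightarrow>
     Lp_norm_pow p w (frac_laplacian (\<alpha> / 2) (?\<phi> x0 \<delta>)) \<le> ennreal (c\<^sub>1 * A * \<delta> powr (?n * p - \<alpha> * p))"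
    using Lp_norm_pow_frac_laplacian_test_bump_le[OF p \<open>0 < \<alpha>\<close>, where 'a='a] by blast
  \<comment> \<open>All constants are independent of the centre and of the radius.\<close>
  define a where "a = c\<^sub>1 * K"
  define b where "b = exp 1 powr p * K * 2 powr (?n * p)"
  define c where "c = (K / (s - ?n)) powr (p - 1)"
  have abc: "0 \<le> a" "0 \<le> b" "0 \<le> c" using c1 K by (auto simp: a_def b_def c_def)
  have bound: "\<mu>w (ball x0 \<delta>) * ennreal_powr (?T x0 \<delta>) (p - 1) \<le> ennreal (c * a * \<epsilon> + c * b * C * \<delta> powr (\<alpha> * p))"
    if \<delta>: "0 < \<delta>" and \<epsilon>: "0 < \<epsilon>" and C: "0 < C"
      and ineq: "\<forall>\<phi>\<in>Cc_infinity. Lp_norm_pow p w (\<lambda>x. complex_of_real (V x) * \<phi> x)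
             \<le> ennreal \<epsilon> * Lp_norm_pow p w (frac_laplacian (\<alpha> / 2) \<phi>) + ennreal C * Lp_norm_pow p w \<phi>"
    for x0 \<delta> \<epsilon> C
  proof -
    let ?S = "S x0 \<delta>"
    have Spos: "0 < ?S" by (rule S0[OF \<delta>])
    let ?X = "\<delta> powr (?n * p - \<alpha> * p)" and ?Y = "\<delta> powr (?n * p)" and ?Z = "?S powr (1 - p)"
    have l: "Lp_norm_pow p w (frac_laplacian (\<alpha> / 2) (?\<phi> x0 \<delta>)) \<le> ennreal (a * ?Z * ?X)"
    proof -
      have "weighted_measure w (ball x0 t) \<le> ennreal (K * ?Z * t powr (?n * p))" if "\<delta> \<le> t" for t
        using Sw[OF \<delta> that, of x0] by (simp add: mult_ac)
      moreover have "0 \<le> K * ?Z" using K by simp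
      ultimately have "Lp_norm_pow p w (frac_laplacian (\<alpha> / 2) (?\<phi> x0 \<delta>)) \<le> ennreal (c\<^sub>1 * (K * ?Z) * ?X)"
        by (intro lap[rule_format] assms(5) \<delta>)
      then show ?thesis by (simp only: a_def mult.assoc)
    qed
    have m: "Lp_norm_pow p w (?\<phi> x0 \<delta>) \<le> ennreal (b * ?Z * ?Y)"
    proof -
      have "Lp_norm_pow p w (?\<phi> x0 \<delta>) \<le> ennreal (exp 1 powr p) * weighted_measure w (ball x0 (2 * \<delta>))"
        using p by (intro Lp_norm_pow_test_bump_le \<delta> assms(5)) simp
      also have "\<dots> \<le> ennreal (exp 1 powr p) * ennreal (K * (2 * \<delta>) powr (?n * p) * ?Z)"
        using \<delta> by (intro mult_left_mono Sw) auto
      also have "\<dots> = ennreal (b * ?Z * ?Y)"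
        using \<delta> by (simp add: b_def powr_mult ennreal_mult'[symmetric] mult_ac)
      finally show ?thesis .
    qed
    have "\<mu>w (ball x0 \<delta>) \<le> Lp_norm_pow p w (\<lambda>x. complex_of_real (V x) * ?\<phi> x0 \<delta> x)"
      unfolding assms(11) using p by (intro weighted_measure_ball_le_test_bump \<delta>) simp
    also have "\<dots> \<le> ennreal \<epsilon> * Lp_norm_pow p w (frac_laplacian (\<alpha> / 2) (?\<phi> x0 \<delta>)) + ennreal C * Lp_norm_pow p w (?\<phi> x0 \<delta>)"
      using ineq bump_affine_Cc_infinity[OF bump_test_bump, of "1 / \<delta>" 1 x0] \<delta> by simp
    also have "\<dots> \<le> ennreal \<epsilon> * ennreal (a * ?Z * ?X) + ennreal C * ennreal (b * ?Z * ?Y)"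
      by (intro add_mono mult_left_mono l m) auto
    also have "\<dots> = ennreal (\<epsilon> * (a * ?Z * ?X) + C * (b * ?Z * ?Y))"
      using \<epsilon> C abc by (simp add: ennreal_mult'[symmetric] ennreal_plus[symmetric] del: ennreal_plus)
    finally have \<mu>: "\<mu>w (ball x0 \<delta>) \<le> ennreal (\<epsilon> * (a * ?Z * ?X) + C * (b * ?Z * ?Y))" .
    have "?T x0 \<delta> \<le> ennreal (K * ?S / \<delta> ^ DIM('a) / (s - ?n) * \<delta> powr (?n - s))"
      unfolding s_def[symmetric]
    proof (rule weighted_tail_integral_le[OF sn \<delta>])
      fix t assume t: "\<delta> \<le> t"
      then have "weighted_measure \<sigma> (ball x0 t) \<le> ennreal (S x0 t)" using \<delta> by (intro S\<sigma>) simp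
      also have "\<dots> \<le> ennreal (K * (t / \<delta>) ^ DIM('a) * ?S)" by (intro ennreal_leI Sdbl \<delta> t)
      finally show "weighted_measure \<sigma> (ball x0 t) \<le> ennreal (K * ?S / \<delta> ^ DIM('a) * t ^ DIM('a))"
        by (simp add: power_divide mult_ac)
    qed (use K Spos \<delta> in auto)
    also have "K * ?S / \<delta> ^ DIM('a) / (s - ?n) * \<delta> powr (?n - s) = K / (s - ?n) * ?S * \<delta> powr (- s)"
      using \<delta> by (simp add: powr_diff powr_realpow powr_minus divide_inverse)
    finally have "ennreal_powr (?T x0 \<delta>) (p - 1) \<le> ennreal ((K / (s - ?n) * ?S * \<delta> powr (- s)) powr (p - 1))"
      using K Spos sn p by (intro ennreal_powr_le) auto
    also have "(K / (s - ?n) * ?S * \<delta> powr (- s)) powr (p - 1) = c * ?S powr (p - 1) * \<delta> powr (\<alpha> * p - ?n * p)"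
    proof -
      have "- s * (p - 1) = \<alpha> * p - ?n * p" using sp by (simp add: algebra_simps)
      then have "(\<delta> powr (- s)) powr (p - 1) = \<delta> powr (\<alpha> * p - ?n * p)" by (simp only: powr_powr)
      moreover have "(q * ?S * \<delta> powr (- s)) powr (p - 1) = q powr (p - 1) * ?S powr (p - 1) * (\<delta> powr (- s)) powr (p - 1)"
        if "0 < q" for q using that Spos by (simp add: powr_mult)
      moreover have "0 < K / (s - ?n)" using K sn by simp
      ultimately show ?thesis by (simp only: c_def)
    qed
    finally have "\<mu>w (ball x0 \<delta>) * ennreal_powr (?T x0 \<delta>) (p - 1)
      \<le> ennreal (\<epsilon> * (a * ?Z * ?X) + C * (b * ?Z * ?Y)) * ennreal (c * ?S powr (p - 1) * \<delta> powr (\<alpha> * p - ?n * p))"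
      by (intro mult_mono \<mu>) auto
    also have "\<dots> = ennreal ((\<epsilon> * (a * ?Z * ?X) + C * (b * ?Z * ?Y)) * (c * ?S powr (p - 1) * \<delta> powr (\<alpha> * p - ?n * p)))"
      using abc by (intro ennreal_mult''[symmetric]) auto
    also have "(\<epsilon> * (a * ?Z * ?X) + C * (b * ?Z * ?Y)) * (c * ?S powr (p - 1) * \<delta> powr (\<alpha> * p - ?n * p))
       = c * a * \<epsilon> + c * b * C * \<delta> powr (\<alpha> * p)"
    proof -
      let ?W = "\<delta> powr (\<alpha> * p - ?n * p)" and ?Q = "?S powr (p - 1)"
      \<comment> \<open>The powers of \<open>S x0 \<delta>\<close> cancel, and only \<open>\<delta> powr (\<alpha> * p)\<close> survives, in the lower-order term.\<close>
      have ZQ: "?Z * ?Q = 1" using Spos by (simp add: powr_add[symmetric])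
      have XW: "?X * ?W = 1" using \<delta> by (simp add: powr_add[symmetric])
      have YW: "?Y * ?W = \<delta> powr (\<alpha> * p)" by (simp add: powr_add[symmetric])
      have "(\<epsilon> * (a * ?Z * ?X) + C * (b * ?Z * ?Y)) * (c * ?Q * ?W)
         = c * a * \<epsilon> * (?Z * ?Q) * (?X * ?W) + c * b * C * (?Z * ?Q) * (?Y * ?W)"
        by (simp add: algebra_simps)
      then show ?thesis by (simp only: ZQ XW YW mult_1_right)
    qed
    finally show ?thesis .
  qed
  show ?thesis
  proof (rule order_tendstoI)
    fix y :: ennreal assume "0 < y"
    then obtain z where z: "0 < z" "z < y" using dense by blast
    then have "z < \<infinity>" by (metis less_le_trans top_greatest infinity_ennreal_def)
    then obtain r where r: "z = ennreal r" "0 < r" using z(1) by (cases z) auto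
    define \<epsilon> where "\<epsilon> = r / (2 * (c * a + 1))"
    have ca: "0 < c * a + 1" using abc by (simp add: add_nonneg_pos)
    have \<epsilon>: "0 < \<epsilon>" using r ca by (simp add: \<epsilon>_def)
    have "c * a * \<epsilon> \<le> (c * a + 1) * \<epsilon>" using \<epsilon> by (intro mult_right_mono) auto
    also have "\<dots> = r / 2"
    proof -
      have "q * (r / (2 * q)) = r / 2" if "0 < q" for q :: real using that by simp
      from this[OF ca] show ?thesis by (simp only: \<epsilon>_def)
    qed
    finally have half: "c * a * \<epsilon> \<le> r / 2" .
    obtain C where C: "0 < C" and ineq: "\<forall>\<phi>\<in>Cc_infinity. Lp_norm_pow p w (\<lambda>x. complex_of_real (V x) * \<phi> x)
             \<le> ennreal \<epsilon> * Lp_norm_pow p w (frac_laplacian (\<alpha> / 2) \<phi>) + ennreal C * Lp_norm_pow p w \<phi>"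
      using assms(10) \<epsilon> by blast
    have "((\<lambda>\<delta>::real. \<delta> powr q) \<longlongrightarrow> 0) (at_right 0)" if "0 < q" for q :: real
      using that by real_asymp
    from tendsto_mult_right_zero[OF this[of "\<alpha> * p"], of "c * b * C"]
    have "((\<lambda>\<delta>. c * b * C * \<delta> powr (\<alpha> * p)) \<longlongrightarrow> 0) (at_right 0)"
      using \<open>0 < \<alpha>\<close> p by simp
    then have "\<forall>\<^sub>F \<delta> in at_right 0. c * b * C * \<delta> powr (\<alpha> * p) < r / 2"
      by (rule order_tendstoD) (use r in simp)
    moreover have "\<forall>\<^sub>F \<delta>::real in at_right 0. 0 < \<delta>" by (rule eventually_at_right_less)
    ultimately show "\<forall>\<^sub>F \<delta> in at_right 0. (SUP x0. \<mu>w (ball x0 \<delta>) * ennreal_powr (?T x0 \<delta>) (p - 1)) < y"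
    proof eventually_elim
      case (elim \<delta>)
      have "(SUP x0. \<mu>w (ball x0 \<delta>) * ennreal_powr (?T x0 \<delta>) (p - 1)) \<le> z"
      proof (rule SUP_least)
        fix x0
        have "c * a * \<epsilon> + c * b * C * \<delta> powr (\<alpha> * p) \<le> r" using half elim(1) by linarith
        with bound[OF elim(2) \<epsilon> C ineq, of x0]
        show "\<mu>w (ball x0 \<delta>) * ennreal_powr (?T x0 \<delta>) (p - 1) \<le> z"
          unfolding r(1) by (meson ennreal_leI order.trans)
      qed
      then show ?case using z(2) by (rule le_less_trans)
    qed
  qed simp
qed

end
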